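(* Let $H$ be a group of nilpotency class two such that $H'=Z(H)$, $H/H'$ is an elementary abelian $2$-group with basis $\{e_1H',\dots,e_dH'\}$, and $H'$ is an elementary abelian $2$-group with basis $\{[e_i,e_j] : 1\le i<j\le d\}$. Let $A=\{1,-1\}$ (multiplicative group), and let $f:(H/H')^3\to A$ be a symmetric trilinear alternating form; write $f(u,v,w)$ for $f(uH',vH',wH')$. Then there exist maps $\delta,\mu:H\times H\to A$ such that (a) $f(u,v,w)=\delta([u,v],w)$ for all $u,v,w\in H$; (b) $\delta(u,v)=\mu(u,v)\mu(v,u)^{-1}$ for all $u,v\in H$; (c) $\mu(uv,w)=\mu(u,w)\mu(v,w)$ and $\mu(u,vw)=\mu(u,v)\mu(u,w)$ for all $u,v,w\in H$ with $\{u,v,w\}\cap H'\neq\emptyset$; (d) in the group $G=A\times H$, $\;z^{yx}\,\delta([z,y],x)=z^{xy}\,\delta([z,x],y)$ for all $x,y,z\in G$, where $\delta$ is regarded as a map $G\times G\to A\times 1\le G$ via the projection $G\to H$ and the identification of $A$ with $A\times 1$; and such that, provided $f$ is nontrivial (not identically $1$), the groupoid $Q=(A\times H,* )$ with operation $$(a,h)*(b,k)=(ab\,\mu(h,k),\,hk)$$ is a loop of nilpotency class three whose inner mapping group is abelian.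
   Context: In a group, $y^x=x^{-1}yx$ and $[y,x]=y^{-1}y^x=y^{-1}x^{-1}yx$; $H'$ is the commutator subgroup. $H/H'$ is viewed as a vector space over the two-element field and $A\cong\mathbb{F}_2$. "Symmetric trilinear alternating" means: $f$ is invariant under all permutations of its arguments, multiplicative in each argument, and equals $1$ whenever two of its arguments coincide. A loop is a set $Q$ with a binary operation and two-sided neutral element $1$ such that the equations $ax=b$ and $ya=b$ have unique solutions $x,y$ for all $a,b$. Translations: $L_x:y\mapsto xy$, $R_x:y\mapsto yx$. The inner mapping group $\mathrm{Inn}\,Q$ is the permutation group generated by all $L_{yx}^{-1}L_yL_x$, $R_{xy}^{-1}R_yR_x$, $R_x^{-1}L_x$ with $x,y\in Q$. The associator $[x,y,z]$ is defined by $(xy)z=(x(yz))[x,y,z]$. The nucleus $N(Q)$ is the set of $x$ with $[x,y,z]=[y,x,z]=[y,z,x]=1$ for all $y,z\in Q$. The center $Z(Q)$ is the set of $x\in N(Q)$ with $xy=yx$ for all $y\in Q$; it is a normal subloop. Put $Q_0=Q$, $Q_{i+1}=Q_i/Z(Q_i)$; $Q$ is of nilpotency class $m$ if $m\ge0$ is least with $Q_m$ trivial. *)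

theory Defs
  imports "HOL-Algebra.Algebra"
begin

section \<open>Loops\<close>

text \<open>The record type \<open>monoid\<close> is used only for its fields (carrier, operation, unit).\<close>

locale loop =
  fixes Q (structure)
  assumes closed: "\<lbrakk>x \<in> carrier Q; y \<in> carrier Q\<rbrakk> \<Longrightarrow> x \<otimes> y \<in> carrier Q"
    and one_in: "\<one> \<in> carrier Q"
    and left_neutral: "x \<in> carrier Q \<Longrightarrow> \<one> \<otimes> x = x"
    and right_neutral: "x \<in> carrier Q \<Longrightarrow> x \<otimes> \<one> = x"
    and left_div: "\<lbrakk>a \<in> carrier Q; b \<in> carrier Q\<rbrakk> \<Longrightarrow> \<exists>!x. x \<in> carrier Q \<and> a \<otimes> x = b"
    and right_div: "\<lbrakk>a \<in> carrier Q; b \<in> carrier Q\<rbrakk> \<Longrightarrow> \<exists>!y. y \<in> carrier Q \<and> y \<otimes> a = b"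

definition left_trans :: "('a, 'm) monoid_scheme \<Rightarrow> 'a \<Rightarrow> 'a \<Rightarrow> 'a" where
  "left_trans Q x = (\<lambda>y\<in>carrier Q. x \<otimes>\<^bsub>Q\<^esub> y)"

definition right_trans :: "('a, 'm) monoid_scheme \<Rightarrow> 'a \<Rightarrow> 'a \<Rightarrow> 'a" where
  "right_trans Q x = (\<lambda>y\<in>carrier Q. y \<otimes>\<^bsub>Q\<^esub> x)"

text \<open>Permutations are multiplied in \<open>BijGroup\<close> as functions, the right factor acting first.\<close>

definition inner_map_gens :: "('a, 'm) monoid_scheme \<Rightarrow> ('a \<Rightarrow> 'a) set" where
  "inner_map_gens Q =
     (let B = BijGroup (carrier Q); L = left_trans Q; R = right_trans Q in
       {inv\<^bsub>B\<^esub> (L (y \<otimes>\<^bsub>Q\<^esub> x)) \<otimes>\<^bsub>B\<^esub> (L y \<otimes>\<^bsub>B\<^esub> L x) | x y. x \<in> carrier Q \<and> y \<in> carrier Q}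
     \<union> {inv\<^bsub>B\<^esub> (R (x \<otimes>\<^bsub>Q\<^esub> y)) \<otimes>\<^bsub>B\<^esub> (R y \<otimes>\<^bsub>B\<^esub> R x) | x y. x \<in> carrier Q \<and> y \<in> carrier Q}
     \<union> {inv\<^bsub>B\<^esub> (R x) \<otimes>\<^bsub>B\<^esub> L x | x. x \<in> carrier Q})"

definition Inn :: "('a, 'm) monoid_scheme \<Rightarrow> ('a \<Rightarrow> 'a) monoid" where
  "Inn Q = BijGroup (carrier Q)
     \<lparr>carrier := generate (BijGroup (carrier Q)) (inner_map_gens Q)\<rparr>"

definition associator :: "('a, 'm) monoid_scheme \<Rightarrow> 'a \<Rightarrow> 'a \<Rightarrow> 'a \<Rightarrow> 'a" where
  "associator Q x y z = (THE w. w \<in> carrier Q \<and>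
     (x \<otimes>\<^bsub>Q\<^esub> y) \<otimes>\<^bsub>Q\<^esub> z = (x \<otimes>\<^bsub>Q\<^esub> (y \<otimes>\<^bsub>Q\<^esub> z)) \<otimes>\<^bsub>Q\<^esub> w)"

definition nucleus :: "('a, 'm) monoid_scheme \<Rightarrow> 'a set" where
  "nucleus Q = {x \<in> carrier Q. \<forall>y \<in> carrier Q. \<forall>z \<in> carrier Q.
     associator Q x y z = \<one>\<^bsub>Q\<^esub> \<and> associator Q y x z = \<one>\<^bsub>Q\<^esub> \<and> associator Q y z x = \<one>\<^bsub>Q\<^esub>}"

definition center :: "('a, 'm) monoid_scheme \<Rightarrow> 'a set" where
  "center Q = {x \<in> nucleus Q. \<forall>y \<in> carrier Q. x \<otimes>\<^bsub>Q\<^esub> y = y \<otimes>\<^bsub>Q\<^esub> x}"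

text \<open>For a group this is the usual center.\<close>

lemma (in group) center_eq:
  "center G = {x \<in> carrier G. \<forall>y \<in> carrier G. x \<otimes> y = y \<otimes> x}"
proof -
  have "associator G x y z = \<one>"
    if "x \<in> carrier G" "y \<in> carrier G" "z \<in> carrier G" for x y z
    unfolding associator_def
    by (rule the_equality) (use that in \<open>auto simp: m_assoc\<close>)
  then show ?thesis
    unfolding center_def nucleus_def by auto
qed

definition center_quot :: "('a, 'm) monoid_scheme \<Rightarrow> 'a set monoid" where
  "center_quot Q = Q Mod center Q"

definition trivial_loop :: "('a, 'm) monoid_scheme \<Rightarrow> bool" where
  "trivial_loop Q \<longleftrightarrow> carrier Q = {\<one>\<^bsub>Q\<^esub>}"

text \<open>
  Passing from \<open>Q\<close> to \<open>Q/Z(Q)\<close> changes the type of the elements, so the sequence \<open>Q\<^sub>0 = Q\<close>,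
  \<open>Q\<^sub>i\<^sub>+\<^sub>1 = Q\<^sub>i/Z(Q\<^sub>i)\<close> cannot be a function of \<open>i\<close>. Classes two and three are therefore spelled
  out: the given \<open>m\<close> is the least index for which \<open>Q\<^sub>m\<close> is trivial. Groups are covered as loops.
\<close>

definition nilpotency_class_two :: "('a, 'm) monoid_scheme \<Rightarrow> bool" where
  "nilpotency_class_two Q \<longleftrightarrow>
     \<not> trivial_loop Q \<and>
     \<not> trivial_loop (center_quot Q) \<and>
     trivial_loop (center_quot (center_quot Q))"

definition nilpotency_class_three :: "('a, 'm) monoid_scheme \<Rightarrow> bool" where
  "nilpotency_class_three Q \<longleftrightarrow>
     \<not> trivial_loop Q \<and>
     \<not> trivial_loop (center_quot Q) \<and>
     \<not> trivial_loop (center_quot (center_quot Q)) \<and>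
     trivial_loop (center_quot (center_quot (center_quot Q)))"


section \<open>Groups\<close>

definition conjugate :: "('a, 'm) monoid_scheme \<Rightarrow> 'a \<Rightarrow> 'a \<Rightarrow> 'a" where
  "conjugate G y x = inv\<^bsub>G\<^esub> x \<otimes>\<^bsub>G\<^esub> y \<otimes>\<^bsub>G\<^esub> x"

definition commutator :: "('a, 'm) monoid_scheme \<Rightarrow> 'a \<Rightarrow> 'a \<Rightarrow> 'a" where
  "commutator G y x = inv\<^bsub>G\<^esub> y \<otimes>\<^bsub>G\<^esub> conjugate G y x"

abbreviation commutator_subgroup :: "('a, 'm) monoid_scheme \<Rightarrow> 'a set" where
  "commutator_subgroup G \<equiv> derived G (carrier G)"

definition elementary_abelian_2 :: "('a, 'm) monoid_scheme \<Rightarrow> bool" where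
  "elementary_abelian_2 V \<longleftrightarrow> comm_group V \<and> (\<forall>x \<in> carrier V. x \<otimes>\<^bsub>V\<^esub> x = \<one>\<^bsub>V\<^esub>)"

text \<open>
  Vector space notions over the two-element field for an elementary abelian 2-group \<open>V\<close>, written
  multiplicatively: the coefficients are 0 and 1, so a linear combination of a family is a product
  over a finite set \<open>S\<close> of indices (those with coefficient 1), and subspaces are subgroups. The
  basis is a family, so repeated members are excluded by independence.
\<close>

definition lin_indep_2 :: "('a, 'm) monoid_scheme \<Rightarrow> 'i set \<Rightarrow> ('i \<Rightarrow> 'a) \<Rightarrow> bool" where
  "lin_indep_2 V I b \<longleftrightarrow>
     (\<forall>S. finite S \<and> S \<subseteq> I \<and> finprod V b S = \<one>\<^bsub>V\<^esub> \<longrightarrow> S = {})"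

definition basis_2 :: "('a, 'm) monoid_scheme \<Rightarrow> 'i set \<Rightarrow> ('i \<Rightarrow> 'a) \<Rightarrow> bool" where
  "basis_2 V I b \<longleftrightarrow>
     b \<in> I \<rightarrow> carrier V \<and> lin_indep_2 V I b \<and> generate V (b ` I) = carrier V"

definition sign_grp :: "int monoid" where
  "sign_grp = \<lparr>carrier = {1, -1}, monoid.mult = (*), one = 1\<rparr>"

text \<open>In a group written multiplicatively, ``linear'' means multiplicative.\<close>

definition sym_trilinear_alternating ::
  "('v, 'm) monoid_scheme \<Rightarrow> ('c, 'n) monoid_scheme \<Rightarrow> ('v \<Rightarrow> 'v \<Rightarrow> 'v \<Rightarrow> 'c) \<Rightarrow> bool" where
  "sym_trilinear_alternating V A f \<longleftrightarrow>
     (\<forall>u \<in> carrier V. \<forall>v \<in> carrier V. \<forall>w \<in> carrier V.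
        f u v w \<in> carrier A \<and>
        f u w v = f u v w \<and> f v u w = f u v w \<and> f v w u = f u v w \<and>
        f w u v = f u v w \<and> f w v u = f u v w) \<and>
     (\<forall>u \<in> carrier V. \<forall>u' \<in> carrier V. \<forall>v \<in> carrier V. \<forall>w \<in> carrier V.
        f (u \<otimes>\<^bsub>V\<^esub> u') v w = f u v w \<otimes>\<^bsub>A\<^esub> f u' v w \<and>
        f v (u \<otimes>\<^bsub>V\<^esub> u') w = f v u w \<otimes>\<^bsub>A\<^esub> f v u' w \<and>
        f v w (u \<otimes>\<^bsub>V\<^esub> u') = f v w u \<otimes>\<^bsub>A\<^esub> f v w u') \<and>
     (\<forall>u \<in> carrier V. \<forall>w \<in> carrier V.
        f u u w = \<one>\<^bsub>A\<^esub> \<and> f u w u = \<one>\<^bsub>A\<^esub> \<and> f w u u = \<one>\<^bsub>A\<^esub>)"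

definition twisted_product ::
  "('c, 'm) monoid_scheme \<Rightarrow> ('a, 'n) monoid_scheme \<Rightarrow> ('a \<Rightarrow> 'a \<Rightarrow> 'c) \<Rightarrow> ('c \<times> 'a) monoid" where
  "twisted_product A H \<mu> =
     \<lparr>carrier = carrier A \<times> carrier H,
      monoid.mult = (\<lambda>(a, h) (b, k). (a \<otimes>\<^bsub>A\<^esub> b \<otimes>\<^bsub>A\<^esub> \<mu> h k, h \<otimes>\<^bsub>H\<^esub> k)),
      one = (\<one>\<^bsub>A\<^esub>, \<one>\<^bsub>H\<^esub>)\<rparr>"

end

theory Submission
  imports Defs
begin

text \<open>
  Write \<open>N = H' = Z(H)\<close>. Since the commutators \<open>[e\<^sub>i, e\<^sub>j]\<close> with \<open>i < j\<close> form a basis of \<open>N\<close>, for each \<open>w\<close>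
  the values \<open>f(e\<^sub>i, e\<^sub>j, w)\<close> extend to a homomorphism \<open>g(-, w)\<close> from \<open>N\<close> to \<open>A\<close>. Both
  \<open>g([u, v], w)\<close> and \<open>f(u, v, w)\<close> are multiplicative in \<open>u\<close> and in \<open>v\<close>, and they agree when \<open>u\<close> and
  \<open>v\<close> lie in \<open>N\<close> or among the \<open>e\<^sub>i\<close>, which generate \<open>H\<close>. So the form \<open>f\<close> factors through the commutator
  map (lemma \<open>commutator_form_factors\<close>).

  The remaining choice is a map \<open>\<zeta>\<close> from \<open>H\<close> to \<open>N\<close> that fixes \<open>N\<close> pointwise and satisfies
  \<open>\<zeta>(c u) = c \<zeta>(u)\<close> for \<open>c\<close> in \<open>N\<close>; it comes from representatives of the cosets of \<open>N\<close>. Then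
  \<open>\<mu>(u, v) = g(\<zeta>(u), v)\<close> and \<open>\<delta>(u, v) = \<mu>(u, v) \<mu>(v, u)\<^sup>-\<^sup>1\<close> have the required properties: \<open>g\<close> is
  trivial on \<open>N \<times> N\<close>, hence \<open>\<mu>\<close> is multiplicative as soon as an argument lies in \<open>N\<close>, and
  \<open>\<delta>(c, w) = g(c, w)\<close> for \<open>c\<close> in \<open>N\<close>. In \<open>A \<times> H\<close> conjugation by \<open>xy\<close> and by \<open>yx\<close> coincide, so the identity
  for conjugates reduces to \<open>\<delta>([z, y], x) = \<delta>([z, x], y)\<close>, which is the symmetry of \<open>f\<close>.

  The statements about the loop \<open>Q\<close> follow from this swap identity and the partial multiplicativity of
  \<open>\<mu>\<close>, on which the locale \<open>class_two_twist\<close> is based.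

  \<^item> The generators of the inner mapping group have one of two shapes
    (lemma \<open>inner_map_gens_shape\<close>): \<open>(a, z) \<mapsto> (a \<phi>(z), z)\<close> with \<open>\<phi>\<close> constant on the cosets of \<open>N\<close>, or
    \<open>(a, z) \<mapsto> (a s\<^sub>x(z), x z x\<^sup>-\<^sup>1)\<close>. As \<open>z\<close> and \<open>x z x\<^sup>-\<^sup>1\<close> lie in the same coset of \<open>N\<close>, maps of the first
    shape commute with all generators. Two maps of the second shape, for \<open>x\<close> and \<open>y\<close>, commute
    because \<open>\<delta>([z, x\<^sup>-\<^sup>1], y) = \<delta>([z, y\<^sup>-\<^sup>1], x)\<close>.

  \<^item> The center of \<open>Q\<close> is \<open>A \<times> K\<close>, where \<open>K\<close> consists of those \<open>n\<close> in \<open>N\<close> with \<open>\<delta>(n, w) = 1\<close> for all \<open>w\<close>.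
    Modulo the center the twist disappears, so \<open>Q/Z(Q)\<close> is the group \<open>H/K\<close>. It has class at most
    two, and if \<open>f\<close> is nontrivial, it is not abelian, because \<open>\<delta>([u, v], w) = f(u, v, w) \<noteq> 1\<close> for
    some \<open>u, v, w\<close>.
\<close>

section \<open>Generators of groups\<close>

lemma hom_eq_on_generate:
  assumes "group G" and "group K"
    and \<phi>: "\<phi> \<in> hom G K" and \<psi>: "\<psi> \<in> hom G K"
    and S: "S \<subseteq> carrier G" and eq: "\<And>s. s \<in> S \<Longrightarrow> \<phi> s = \<psi> s"
    and x: "x \<in> generate G S"
  shows "\<phi> x = \<psi> x"
proof -
  interpret \<phi>: group_hom G K \<phi>
    using assms by (simp add: group_hom_def group_hom_axioms_def)
  interpret \<psi>: group_hom G K \<psi>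
    using assms by (simp add: group_hom_def group_hom_axioms_def)
  show ?thesis
    using x
  proof induction
    case (inv h)
    then show ?case using S eq by (simp add: subset_iff)
  next
    case (eng h1 h2)
    then show ?case using \<phi>.G.generate_in_carrier[OF S] by simp
  qed (use eq in simp_all)
qed

lemma (in group) centralizer_subgroup:
  assumes "x \<in> carrier G"
  shows "subgroup {y \<in> carrier G. x \<otimes> y = y \<otimes> x} G"
proof (rule subgroupI)
  fix a b assume ab: "a \<in> {y \<in> carrier G. x \<otimes> y = y \<otimes> x}" "b \<in> {y \<in> carrier G. x \<otimes> y = y \<otimes> x}"
  have "x \<otimes> inv a = inv a \<otimes> x"
    using ab assms by (metis (mono_tags, lifting) inv_closed inv_solve_left inv_solve_right m_assoc m_closed mem_Collect_eq)
  then show "inv a \<in> {y \<in> carrier G. x \<otimes> y = y \<otimes> x}" using ab by simp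
  have "x \<otimes> (a \<otimes> b) = (a \<otimes> x) \<otimes> b"
    using ab assms by (simp flip: m_assoc)
  also have "\<dots> = (a \<otimes> b) \<otimes> x"
    using ab assms by (simp add: m_assoc)
  finally show "a \<otimes> b \<in> {y \<in> carrier G. x \<otimes> y = y \<otimes> x}" using ab by simp
qed (use assms in auto)

lemma (in group) generate_commuting_comm_group:
  assumes S: "S \<subseteq> carrier G"
    and comm: "\<And>x y. x \<in> S \<Longrightarrow> y \<in> S \<Longrightarrow> x \<otimes> y = y \<otimes> x"
  shows "comm_group (G\<lparr>carrier := generate G S\<rparr>)"
proof -
  have gen: "generate G S \<subseteq> carrier G"
    using generate_in_carrier[OF S] by blast
  have *: "x \<otimes> y = y \<otimes> x" if "x \<in> S" "y \<in> generate G S" for x y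
    using generate_subgroup_incl[OF _ centralizer_subgroup[of x], of S] that S comm by blast
  have "x \<otimes> y = y \<otimes> x" if "x \<in> generate G S" "y \<in> generate G S" for x y
  proof -
    have y: "y \<in> carrier G" using that gen by blast
    have "S \<subseteq> {z \<in> carrier G. y \<otimes> z = z \<otimes> y}"
      using * that S by fastforce
    then show ?thesis
      using generate_subgroup_incl[OF _ centralizer_subgroup[OF y], of S] that by auto
  qed
  then show ?thesis
    by (intro group.group_comm_groupI)
      (use generate_is_subgroup[OF S] subgroup.subgroup_is_group[OF _ is_group] in auto)
qed

lemma (in group) inv_eq_self_if_square:
  assumes "x \<in> carrier G" "x \<otimes> x = \<one>"
  shows "inv x = x"
  using assms inv_equality by blast

section \<open>Linear extension over the two-element field\<close>

text \<open>The factors over \<open>S \<inter> T\<close> occur twice and cancel.\<close>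

lemma (in comm_group) finprod_symdiff:
  assumes sq: "\<And>x. x \<in> carrier G \<Longrightarrow> x \<otimes> x = \<one>"
    and "finite S" "finite T" and b: "b \<in> S \<union> T \<rightarrow> carrier G"
  shows "finprod G b S \<otimes> finprod G b T = finprod G b (sym_diff S T)"
proof -
  define p where "p Y = finprod G b Y" for Y
  have car: "p Y \<in> carrier G" if "Y \<subseteq> S \<union> T" for Y
    using b that unfolding p_def by (intro finprod_closed) auto
  have split: "p (Y \<union> Z) = p Y \<otimes> p Z"
    if "Y \<inter> Z = {}" "Y \<subseteq> S \<union> T" "Z \<subseteq> S \<union> T" for Y Z
    using that b assms(2,3) unfolding p_def by (intro finprod_Un_disjoint) (auto intro: finite_subset)
  have S: "p S = p (S - T) \<otimes> p (S \<inter> T)"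
  proof -
    have "(S - T) \<union> (S \<inter> T) = S" by blast
    then show ?thesis using split[of "S - T" "S \<inter> T"] by auto
  qed
  have T: "p T = p (S \<inter> T) \<otimes> p (T - S)"
  proof -
    have "(S \<inter> T) \<union> (T - S) = T" by blast
    then show ?thesis using split[of "S \<inter> T" "T - S"] by auto
  qed
  have c: "p (S - T) \<in> carrier G" "p (S \<inter> T) \<in> carrier G" "p (T - S) \<in> carrier G"
    by (rule car, blast)+
  have "p S \<otimes> p T = p (S - T) \<otimes> (p (S \<inter> T) \<otimes> p (S \<inter> T)) \<otimes> p (T - S)"
    unfolding S T using c by (simp add: m_assoc)
  also have "\<dots> = p (S - T) \<otimes> p (T - S)"
    using c sq by simp
  also have "\<dots> = p (sym_diff S T)"
    by (rule split[symmetric]) blast+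
  finally show ?thesis unfolding p_def .
qed

text \<open>
  Every vector is the product of the basis over exactly one finite set of indices, its support. The
  extension multiplies the prescribed values over the support; it is a homomorphism because the
  support of a product is the symmetric difference of the supports.
\<close>

lemma elementary_abelian_2_extend_basis:
  assumes V: "elementary_abelian_2 V" and K: "elementary_abelian_2 K"
    and basis: "basis_2 V I b" and c: "c \<in> I \<rightarrow> carrier K"
  shows "\<exists>\<phi> \<in> hom V K. \<forall>i \<in> I. \<phi> (b i) = c i"
proof -
  interpret V: comm_group V using V by (simp add: elementary_abelian_2_def)
  interpret K: comm_group K using K by (simp add: elementary_abelian_2_def)
  have sqV: "x \<otimes>\<^bsub>V\<^esub> x = \<one>\<^bsub>V\<^esub>" if "x \<in> carrier V" for x
    using V that by (simp add: elementary_abelian_2_def)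
  have sqK: "x \<otimes>\<^bsub>K\<^esub> x = \<one>\<^bsub>K\<^esub>" if "x \<in> carrier K" for x
    using K that by (simp add: elementary_abelian_2_def)
  have b: "b \<in> I \<rightarrow> carrier V" and indep: "lin_indep_2 V I b"
    and gen: "generate V (b ` I) = carrier V"
    using basis by (auto simp: basis_2_def)
  have symV: "finprod V b S \<otimes>\<^bsub>V\<^esub> finprod V b T = finprod V b (sym_diff S T)"
    if "finite S" "S \<subseteq> I" "finite T" "T \<subseteq> I" for S T
    using that b by (intro V.finprod_symdiff sqV) auto
  have symK: "finprod K c S \<otimes>\<^bsub>K\<^esub> finprod K c T = finprod K c (sym_diff S T)"
    if "finite S" "S \<subseteq> I" "finite T" "T \<subseteq> I" for S T
    using that c by (intro K.finprod_symdiff sqK) auto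
  have closed: "finprod V b S \<in> carrier V" if "S \<subseteq> I" for S
    using that b by (intro V.finprod_closed) auto
  have singV: "finprod V b {i} = b i" if "i \<in> I" for i
    using V.finprod_insert[of "{}" i b] funcset_mem[OF b that] by simp
  have singK: "finprod K c {i} = c i" if "i \<in> I" for i
    using K.finprod_insert[of "{}" i c] funcset_mem[OF c that] by simp
  have uniq: "S = T"
    if "finite S" "S \<subseteq> I" "finite T" "T \<subseteq> I" "finprod V b S = finprod V b T" for S T
  proof -
    have "finprod V b (sym_diff S T) = \<one>\<^bsub>V\<^esub>"
      using symV[OF that(1-4)] that(5) sqV closed[OF that(4)] by simp
    moreover have "finite (sym_diff S T)" "sym_diff S T \<subseteq> I"
      using that by auto
    ultimately have "sym_diff S T = {}"
      using indep unfolding lin_indep_2_def by metis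
    then show "S = T" by auto
  qed
  have span: "\<exists>S. finite S \<and> S \<subseteq> I \<and> v = finprod V b S" if "v \<in> carrier V" for v
  proof -
    have "v \<in> generate V (b ` I)" using that gen by simp
    then show ?thesis
    proof induction
      case one
      show ?case by (rule exI[of _ "{}"]) simp
    next
      case (incl h)
      then obtain i where "i \<in> I" "h = b i" by blast
      then show ?case by (intro exI[of _ "{i}"]) (simp add: singV)
    next
      case (inv h)
      then obtain i where i: "i \<in> I" "h = b i" by blast
      then have "inv\<^bsub>V\<^esub> h = b i"
        using funcset_mem[OF b i(1)] sqV V.inv_eq_self_if_square by simp
      then show ?case using i by (intro exI[of _ "{i}"]) (simp add: singV)
    next
      case (eng h1 h2)
      then obtain S T where "finite S" "S \<subseteq> I" "h1 = finprod V b S"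
        "finite T" "T \<subseteq> I" "h2 = finprod V b T" by blast
      then show ?case using symV by (intro exI[of _ "sym_diff S T"]) auto
    qed
  qed
  define supp where "supp v = (THE S. finite S \<and> S \<subseteq> I \<and> v = finprod V b S)" for v
  have supp: "supp (finprod V b S) = S" if "finite S" "S \<subseteq> I" for S
    unfolding supp_def using that uniq by (intro the_equality) auto
  define \<phi> where "\<phi> v = finprod K c (supp v)" for v
  have \<phi>: "\<phi> (finprod V b S) = finprod K c S" if "finite S" "S \<subseteq> I" for S
    using that by (simp add: \<phi>_def supp)
  have "\<phi> \<in> hom V K"
  proof (rule homI)
    fix x y assume "x \<in> carrier V" "y \<in> carrier V"
    then obtain S T where S: "finite S" "S \<subseteq> I" "x = finprod V b S"
      and T: "finite T" "T \<subseteq> I" "y = finprod V b T" using span by meson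
    show "\<phi> x \<in> carrier K"
      using S c by (auto simp: \<phi> intro!: K.finprod_closed)
    have "sym_diff S T \<subseteq> I" using S T by blast
    then show "\<phi> (x \<otimes>\<^bsub>V\<^esub> y) = \<phi> x \<otimes>\<^bsub>K\<^esub> \<phi> y"
      using S T by (simp add: symV symK \<phi>)
  qed
  moreover have "\<phi> (b i) = c i" if "i \<in> I" for i
    using \<phi>[of "{i}"] that by (simp add: singV singK)
  ultimately show ?thesis by blast
qed

section \<open>Inner mappings and central quotients of loops\<close>

lemma (in loop) left_trans_Bij:
  assumes "x \<in> carrier Q"
  shows "left_trans Q x \<in> Bij (carrier Q)"
proof -
  have "bij_betw (\<lambda>y. x \<otimes> y) (carrier Q) (carrier Q)"
    unfolding bij_betw_def inj_on_def
  proof (intro conjI ballI impI)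
    fix y z assume "y \<in> carrier Q" "z \<in> carrier Q" "x \<otimes> y = x \<otimes> z"
    then show "y = z" using left_div[OF assms, of "x \<otimes> z"] closed assms by metis
  next
    show "(\<lambda>y. x \<otimes> y) ` carrier Q = carrier Q"
    proof
      show "(\<lambda>y. x \<otimes> y) ` carrier Q \<subseteq> carrier Q" using closed assms by blast
      show "carrier Q \<subseteq> (\<lambda>y. x \<otimes> y) ` carrier Q"
        using left_div[OF assms] by (metis (no_types, lifting) image_eqI subsetI)
    qed
  qed
  then show ?thesis by (auto simp: Bij_def left_trans_def bij_betw_restrict_eq)
qed

lemma (in loop) right_trans_Bij:
  assumes "x \<in> carrier Q"
  shows "right_trans Q x \<in> Bij (carrier Q)"
proof -
  have "bij_betw (\<lambda>y. y \<otimes> x) (carrier Q) (carrier Q)"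
    unfolding bij_betw_def inj_on_def
  proof (intro conjI ballI impI)
    fix y z assume "y \<in> carrier Q" "z \<in> carrier Q" "y \<otimes> x = z \<otimes> x"
    then show "y = z" using right_div[OF assms, of "z \<otimes> x"] closed assms by metis
  next
    show "(\<lambda>y. y \<otimes> x) ` carrier Q = carrier Q"
    proof
      show "(\<lambda>y. y \<otimes> x) ` carrier Q \<subseteq> carrier Q" using closed assms by blast
      show "carrier Q \<subseteq> (\<lambda>y. y \<otimes> x) ` carrier Q"
        using right_div[OF assms] by (metis (no_types, lifting) image_eqI subsetI)
    qed
  qed
  then show ?thesis by (auto simp: Bij_def right_trans_def bij_betw_restrict_eq)
qed

lemma BijGroup_mult_apply:
  assumes "f \<in> Bij S" "g \<in> Bij S" "x \<in> S"
  shows "(f \<otimes>\<^bsub>BijGroup S\<^esub> g) x = f (g x)"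
  using assms by (simp add: BijGroup_def compose_def)

lemma BijGroup_left_divide_apply:
  assumes "f \<in> Bij S" "g \<in> Bij S" "x \<in> S" "w \<in> S" and "f w = g x"
  shows "(inv\<^bsub>BijGroup S\<^esub> f \<otimes>\<^bsub>BijGroup S\<^esub> g) x = w"
proof -
  have "inv\<^bsub>BijGroup S\<^esub> f \<in> Bij S"
    unfolding inv_BijGroup[OF assms(1)] by (rule restrict_inv_into_Bij[OF assms(1)])
  then have "(inv\<^bsub>BijGroup S\<^esub> f \<otimes>\<^bsub>BijGroup S\<^esub> g) x = (inv\<^bsub>BijGroup S\<^esub> f) (f w)"
    using assms by (simp add: BijGroup_mult_apply)
  also have "\<dots> = inv_into S f (f w)"
    using assms(1,4) Bij_imp_funcset[OF assms(1)] by (simp add: inv_BijGroup Pi_iff)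
  also have "\<dots> = w"
    using assms(1,4) by (simp add: Bij_def bij_betw_def)
  finally show ?thesis .
qed

text \<open>
  In this form a generator can be computed by checking an equation between products in the loop;
  inverses of translations no longer occur.
\<close>

lemma (in loop) inner_map_gens_cases:
  assumes "p \<in> inner_map_gens Q"
  obtains
    (left) x y where "x \<in> carrier Q" "y \<in> carrier Q" "p \<in> Bij (carrier Q)"
      "\<And>z w. \<lbrakk>z \<in> carrier Q; w \<in> carrier Q; (y \<otimes> x) \<otimes> w = y \<otimes> (x \<otimes> z)\<rbrakk> \<Longrightarrow> p z = w"
  | (right) x y where "x \<in> carrier Q" "y \<in> carrier Q" "p \<in> Bij (carrier Q)"
      "\<And>z w. \<lbrakk>z \<in> carrier Q; w \<in> carrier Q; w \<otimes> (x \<otimes> y) = (z \<otimes> x) \<otimes> y\<rbrakk> \<Longrightarrow> p z = w"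
  | (mid) x where "x \<in> carrier Q" "p \<in> Bij (carrier Q)"
      "\<And>z w. \<lbrakk>z \<in> carrier Q; w \<in> carrier Q; w \<otimes> x = x \<otimes> z\<rbrakk> \<Longrightarrow> p z = w"
proof -
  let ?B = "BijGroup (carrier Q)" and ?L = "left_trans Q" and ?R = "right_trans Q"
  interpret B: group ?B by (rule group_BijGroup)
  have cB: "carrier ?B = Bij (carrier Q)" by (simp add: BijGroup_def)
  note mB = B.m_closed[unfolded cB] and iB = B.inv_closed[unfolded cB]
  note L = left_trans_Bij and R = right_trans_Bij
  have apL: "?L x z = x \<otimes> z" and apR: "?R x z = z \<otimes> x" if "z \<in> carrier Q" for x z
    using that by (simp_all add: left_trans_def right_trans_def)
  from assms consider
    (1) x y where "x \<in> carrier Q" "y \<in> carrier Q"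
      "p = inv\<^bsub>?B\<^esub> (?L (y \<otimes> x)) \<otimes>\<^bsub>?B\<^esub> (?L y \<otimes>\<^bsub>?B\<^esub> ?L x)"
  | (2) x y where "x \<in> carrier Q" "y \<in> carrier Q"
      "p = inv\<^bsub>?B\<^esub> (?R (x \<otimes> y)) \<otimes>\<^bsub>?B\<^esub> (?R y \<otimes>\<^bsub>?B\<^esub> ?R x)"
  | (3) x where "x \<in> carrier Q" "p = inv\<^bsub>?B\<^esub> (?R x) \<otimes>\<^bsub>?B\<^esub> ?L x"
    by (auto simp: inner_map_gens_def Let_def)
  then show thesis
  proof cases
    case 1
    have "p z = w" if "z \<in> carrier Q" "w \<in> carrier Q" "(y \<otimes> x) \<otimes> w = y \<otimes> (x \<otimes> z)" for z w
      unfolding 1(3) using that 1(1,2)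
      by (intro BijGroup_left_divide_apply)
        (simp_all add: L mB closed BijGroup_mult_apply apL)
    then show thesis using left[of x y] 1 by (simp add: L mB iB closed)
  next
    case 2
    have "p z = w" if "z \<in> carrier Q" "w \<in> carrier Q" "w \<otimes> (x \<otimes> y) = (z \<otimes> x) \<otimes> y" for z w
      unfolding 2(3) using that 2(1,2)
      by (intro BijGroup_left_divide_apply)
        (simp_all add: R mB closed BijGroup_mult_apply apR)
    then show thesis using right[of x y] 2 by (simp add: R mB iB closed)
  next
    case 3
    have "p z = w" if "z \<in> carrier Q" "w \<in> carrier Q" "w \<otimes> x = x \<otimes> z" for z w
      unfolding 3(2) using that 3(1)
      by (intro BijGroup_left_divide_apply) (simp_all add: L R apL apR)
    then show thesis using mid[of x] 3 by (simp add: L R mB iB)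
  qed
qed

lemma (in loop) associator_eq_one:
  assumes "x \<in> carrier Q" "y \<in> carrier Q" "z \<in> carrier Q"
    and "(x \<otimes> y) \<otimes> z = x \<otimes> (y \<otimes> z)"
  shows "associator Q x y z = \<one>"
  unfolding associator_def
proof (rule the_equality)
  have c: "x \<otimes> (y \<otimes> z) \<in> carrier Q" using assms closed by simp
  show "\<one> \<in> carrier Q \<and> (x \<otimes> y) \<otimes> z = (x \<otimes> (y \<otimes> z)) \<otimes> \<one>"
    using assms c one_in right_neutral by simp
  fix w assume "w \<in> carrier Q \<and> (x \<otimes> y) \<otimes> z = (x \<otimes> (y \<otimes> z)) \<otimes> w"
  then show "w = \<one>"
    using left_div[OF c c] one_in right_neutral[OF c] assms(4) by metis
qed

lemma (in group) center_subgroup: "subgroup (center G) G"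
proof (rule subgroupI)
  define C where "C y = {z \<in> carrier G. y \<otimes> z = z \<otimes> y}" for y
  have C: "subgroup (C y) G" if "y \<in> carrier G" for y
    unfolding C_def by (rule centralizer_subgroup[OF that])
  have mem: "a \<in> center G \<longleftrightarrow> a \<in> carrier G \<and> (\<forall>y \<in> carrier G. a \<in> C y)" for a
    unfolding center_eq C_def mem_Collect_eq by metis
  fix a b assume a: "a \<in> center G" and b: "b \<in> center G"
  show "inv a \<in> center G"
    using a subgroup.m_inv_closed[OF C] unfolding mem by blast
  show "a \<otimes> b \<in> center G"
    using a b subgroup.m_closed[OF C] unfolding mem by blast
next
  show "center G \<noteq> {}" using center_eq by auto
qed (auto simp: center_eq)

lemma (in group) normal_if_subset_center:
  assumes K: "subgroup K G" "K \<subseteq> center G"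
  shows "K \<lhd> G"
proof (rule normalI[OF K(1)], intro ballI)
  fix x assume "x \<in> carrier G"
  then have "k \<otimes> x = x \<otimes> k" if "k \<in> K" for k
    using K(2) that by (auto simp: center_eq)
  then show "K #> x = x <# K" by (simp add: r_coset_def l_coset_def)
qed

lemma (in comm_group) trivial_loop_center_quot: "trivial_loop (center_quot G)"
proof -
  have Z: "center G = carrier G" by (auto simp: center_eq m_comm)
  have "carrier G #> x = carrier G" if "x \<in> carrier G" for x
    using coset_join2[OF that subgroup_self that] .
  then show ?thesis
    unfolding trivial_loop_def center_quot_def carrier_FactGroup Z
    by auto
qed

lemma (in group) commute_if_trivial_loop_center_quot:
  assumes "trivial_loop (center_quot G)" "x \<in> carrier G" "y \<in> carrier G"
  shows "x \<otimes> y = y \<otimes> x"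
proof -
  have "center G #> x = center G"
    using assms by (auto simp: trivial_loop_def center_quot_def carrier_FactGroup)
  then have "x \<in> center G"
    using rcos_self[OF assms(2) center_subgroup] by simp
  then show ?thesis using assms(3) by (auto simp: center_eq)
qed

text \<open>Commutators die in the quotient by the center, and an abelian group is its own center.\<close>

lemma (in group) trivial_loop_second_center_quot:
  assumes "\<And>x y. x \<in> carrier G \<Longrightarrow> y \<in> carrier G \<Longrightarrow> \<exists>c \<in> center G. x \<otimes> y = c \<otimes> (y \<otimes> x)"
  shows "trivial_loop (center_quot (center_quot G))"
proof -
  interpret Z: normal "center G" G
    by (rule normal_if_subset_center[OF center_subgroup order_refl])
  have eq: "center G #> (x \<otimes> y) = center G #> (y \<otimes> x)" if xy: "x \<in> carrier G" "y \<in> carrier G" for x y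
  proof -
    obtain c where "c \<in> center G" "x \<otimes> y = c \<otimes> (y \<otimes> x)" using assms[OF xy] by blast
    then have "x \<otimes> y \<in> center G #> (y \<otimes> x)" by (auto simp: r_coset_def)
    then show ?thesis using repr_independence[OF _ _ center_subgroup] xy by auto
  qed
  have "comm_group (center_quot G)"
    unfolding center_quot_def
    by (rule group.group_comm_groupI[OF Z.factorgroup_is_group])
      (auto simp: carrier_FactGroup Z.rcos_sum eq)
  then show ?thesis by (rule comm_group.trivial_loop_center_quot)
qed

lemma (in comm_group) mult_mult_eq_iff:
  assumes "a \<in> carrier G" "b \<in> carrier G" "m \<in> carrier G" "x \<in> carrier G"
  shows "a \<otimes> x \<otimes> m = b \<longleftrightarrow> x = inv a \<otimes> b \<otimes> inv m"
proof
  assume b: "a \<otimes> x \<otimes> m = b"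
  have "inv a \<otimes> (a \<otimes> x \<otimes> m) \<otimes> inv m = (inv a \<otimes> a) \<otimes> x \<otimes> (m \<otimes> inv m)"
    using assms by (simp only: m_assoc inv_closed m_closed)
  then show "x = inv a \<otimes> b \<otimes> inv m" using assms b by simp
next
  assume "x = inv a \<otimes> b \<otimes> inv m"
  then have "a \<otimes> x \<otimes> m = (a \<otimes> inv a) \<otimes> b \<otimes> (inv m \<otimes> m)"
    using assms by (simp only: m_assoc inv_closed m_closed)
  then show "a \<otimes> x \<otimes> m = b" using assms by simp
qed

section \<open>Commutators in a group of class two\<close>

locale class_two_group = group +
  assumes commutator_center: "\<lbrakk>u \<in> carrier G; v \<in> carrier G\<rbrakk> \<Longrightarrow> commutator G u v \<in> center G"
begin

lemma center_closed: "c \<in> center G \<Longrightarrow> c \<in> carrier G"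
  and center_commute: "c \<in> center G \<Longrightarrow> x \<in> carrier G \<Longrightarrow> c \<otimes> x = x \<otimes> c"
  by (auto simp: center_eq)

lemma commutator_closed [simp]: "\<lbrakk>u \<in> carrier G; v \<in> carrier G\<rbrakk> \<Longrightarrow> commutator G u v \<in> carrier G"
  using commutator_center center_closed by blast

lemma commutator_unique:
  assumes "u \<in> carrier G" "v \<in> carrier G" "c \<in> carrier G" and "u \<otimes> v = v \<otimes> u \<otimes> c"
  shows "commutator G u v = c"
proof -
  have "commutator G u v = inv (v \<otimes> u) \<otimes> (u \<otimes> v)"
    using assms(1,2) by (simp add: commutator_def conjugate_def inv_mult_group m_assoc)
  also have "\<dots> = c"
    using assms inv_solve_left'[of "c" "v \<otimes> u" "v \<otimes> u \<otimes> c"] by simp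
  finally show ?thesis .
qed

lemma mult_swap:
  assumes "u \<in> carrier G" "v \<in> carrier G"
  shows "u \<otimes> v = v \<otimes> u \<otimes> commutator G u v"
proof -
  have "commutator G u v = inv (v \<otimes> u) \<otimes> (u \<otimes> v)"
    using assms by (simp add: commutator_def conjugate_def inv_mult_group m_assoc)
  then show ?thesis using assms by (simp flip: m_assoc)
qed

lemma commutator_mult_left:
  assumes "u \<in> carrier G" "v \<in> carrier G" "w \<in> carrier G"
  shows "commutator G (u \<otimes> v) w = commutator G u w \<otimes> commutator G v w"
proof (rule commutator_unique)
  let ?a = "commutator G u w" and ?b = "commutator G v w"
  have c: "?a \<in> carrier G" "?b \<in> carrier G" using assms commutator_closed by auto
  have "u \<otimes> v \<otimes> w = u \<otimes> (v \<otimes> w)" using assms by (simp add: m_assoc)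
  also have "\<dots> = u \<otimes> w \<otimes> v \<otimes> ?b"
    unfolding mult_swap[OF assms(2,3)] using assms c by (simp add: m_assoc)
  also have "\<dots> = w \<otimes> u \<otimes> (?a \<otimes> v) \<otimes> ?b"
    unfolding mult_swap[OF assms(1,3)] using assms c by (simp add: m_assoc)
  also have "?a \<otimes> v = v \<otimes> ?a"
    using assms by (intro center_commute commutator_center)
  also have "w \<otimes> u \<otimes> (v \<otimes> ?a) \<otimes> ?b = w \<otimes> (u \<otimes> v) \<otimes> (?a \<otimes> ?b)"
    using assms c by (simp add: m_assoc)
  finally show "u \<otimes> v \<otimes> w = w \<otimes> (u \<otimes> v) \<otimes> (?a \<otimes> ?b)" .
qed (use assms in simp_all)

lemma commutator_swap:
  assumes "u \<in> carrier G" "v \<in> carrier G"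
  shows "commutator G v u = inv (commutator G u v)"
proof (rule commutator_unique)
  show "v \<otimes> u = u \<otimes> v \<otimes> inv (commutator G u v)"
    unfolding mult_swap[OF assms] using assms commutator_closed by (simp add: m_assoc)
qed (use assms in simp_all)

lemma commutator_mult_right:
  assumes "u \<in> carrier G" "v \<in> carrier G" "w \<in> carrier G"
  shows "commutator G u (v \<otimes> w) = commutator G u v \<otimes> commutator G u w"
proof -
  have "commutator G u (v \<otimes> w) = inv (commutator G v u \<otimes> commutator G w u)"
    using assms by (simp add: commutator_swap[of "v \<otimes> w" u] commutator_mult_left)
  also have "\<dots> = commutator G u w \<otimes> commutator G u v"
    using assms by (simp add: inv_mult_group commutator_closed commutator_swap[of v u] commutator_swap[of w u])
  also have "\<dots> = commutator G u v \<otimes> commutator G u w"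
    using assms by (intro center_commute commutator_center commutator_closed)
  finally show ?thesis .
qed

lemma commutator_self: "u \<in> carrier G \<Longrightarrow> commutator G u u = \<one>"
  by (rule commutator_unique) auto

lemma commutator_central_left:
  assumes "c \<in> center G" "u \<in> carrier G"
  shows "commutator G c u = \<one>"
  using assms center_closed center_commute[OF assms] by (intro commutator_unique) simp_all

lemma commutator_central_right:
  assumes "c \<in> center G" "u \<in> carrier G"
  shows "commutator G u c = \<one>"
  using commutator_swap[OF center_closed[OF assms(1)] assms(2)] commutator_central_left[OF assms]
  by simp

end

text \<open>
  The conjugate is \<open>z [z, x] [z, y]\<close> in either case: commutators are central and multiplicative.
\<close>

lemma (in class_two_group) conjugate_mult_swap:
  assumes "x \<in> carrier G" "y \<in> carrier G" "z \<in> carrier G"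
  shows "conjugate G z (y \<otimes> x) = conjugate G z (x \<otimes> y)"
proof -
  have conj: "conjugate G z w = z \<otimes> commutator G z w" if "w \<in> carrier G" for w
    using assms that by (simp add: commutator_def conjugate_def flip: m_assoc)
  show ?thesis
    using assms center_commute[of "commutator G z x" "commutator G z y"]
    by (simp add: conj commutator_mult_right commutator_center)
qed

section \<open>Twisting a group of class two\<close>

text \<open>
  The standing hypothesis is that \<open>\<mu>\<close> is multiplicative in each argument as soon as one of the three
  elements involved is central. If it were so for all elements, the twisted product would be a group.
\<close>

locale class_two_twist =
  A: comm_group A + H: class_two_group H
  for A :: "('c, 'm) monoid_scheme" and H :: "('a, 'n) monoid_scheme" +
  fixes \<mu> :: "'a \<Rightarrow> 'a \<Rightarrow> 'c"
  assumes mu_closed [simp, intro]: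
      "\<lbrakk>u \<in> carrier H; v \<in> carrier H\<rbrakk> \<Longrightarrow> \<mu> u v \<in> carrier A"
    and mu_mult_left:
      "\<lbrakk>u \<in> carrier H; v \<in> carrier H; w \<in> carrier H; {u, v, w} \<inter> center H \<noteq> {}\<rbrakk>
       \<Longrightarrow> \<mu> (u \<otimes>\<^bsub>H\<^esub> v) w = \<mu> u w \<otimes>\<^bsub>A\<^esub> \<mu> v w"
    and mu_mult_right:
      "\<lbrakk>u \<in> carrier H; v \<in> carrier H; w \<in> carrier H; {u, v, w} \<inter> center H \<noteq> {}\<rbrakk>
       \<Longrightarrow> \<mu> u (v \<otimes>\<^bsub>H\<^esub> w) = \<mu> u v \<otimes>\<^bsub>A\<^esub> \<mu> u w"
begin

definition \<delta> :: "'a \<Rightarrow> 'a \<Rightarrow> 'c" where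
  "\<delta> u v = \<mu> u v \<otimes>\<^bsub>A\<^esub> inv\<^bsub>A\<^esub> \<mu> v u"

abbreviation "N \<equiv> center H"
abbreviation "Q \<equiv> twisted_product A H \<mu>"

lemma one_N: "\<one>\<^bsub>H\<^esub> \<in> N"
  using H.center_subgroup by (rule subgroup.one_closed)

lemma delta_closed: "\<lbrakk>u \<in> carrier H; v \<in> carrier H\<rbrakk> \<Longrightarrow> \<delta> u v \<in> carrier A"
  by (simp add: \<delta>_def)

lemma mu_one_left: "v \<in> carrier H \<Longrightarrow> \<mu> \<one>\<^bsub>H\<^esub> v = \<one>\<^bsub>A\<^esub>"
  using mu_mult_left[of "\<one>\<^bsub>H\<^esub>" "\<one>\<^bsub>H\<^esub>" v] one_N by simp

lemma mu_one_right: "v \<in> carrier H \<Longrightarrow> \<mu> v \<one>\<^bsub>H\<^esub> = \<one>\<^bsub>A\<^esub>"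
  using mu_mult_right[of v "\<one>\<^bsub>H\<^esub>" "\<one>\<^bsub>H\<^esub>"] one_N by simp

lemma mu_inv_left: "\<lbrakk>n \<in> N; v \<in> carrier H\<rbrakk> \<Longrightarrow> \<mu> (inv\<^bsub>H\<^esub> n) v = inv\<^bsub>A\<^esub> \<mu> n v"
  using mu_mult_left[of "inv\<^bsub>H\<^esub> n" n v] mu_one_left[of v] H.center_closed[of n]
  by (intro A.inv_equality[symmetric]) auto

lemma mu_inv_right: "\<lbrakk>n \<in> N; v \<in> carrier H\<rbrakk> \<Longrightarrow> \<mu> v (inv\<^bsub>H\<^esub> n) = inv\<^bsub>A\<^esub> \<mu> v n"
  using mu_mult_right[of v "inv\<^bsub>H\<^esub> n" n] mu_one_right[of v] H.center_closed[of n]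
  by (intro A.inv_equality[symmetric]) auto

lemma delta_inv_right:
  assumes "n \<in> N" "v \<in> carrier H"
  shows "\<delta> n (inv\<^bsub>H\<^esub> v) = inv\<^bsub>A\<^esub> \<delta> n v"
proof -
  have n: "n \<in> carrier H" using assms H.center_closed by simp
  have "\<mu> n (inv\<^bsub>H\<^esub> v) = inv\<^bsub>A\<^esub> \<mu> n v"
    using mu_mult_right[of n "inv\<^bsub>H\<^esub> v" v] mu_one_right[of n] n assms
    by (intro A.inv_equality[symmetric]) auto
  moreover have "\<mu> (inv\<^bsub>H\<^esub> v) n = inv\<^bsub>A\<^esub> \<mu> v n"
    using mu_mult_left[of "inv\<^bsub>H\<^esub> v" v n] mu_one_left[of n] n assms
    by (intro A.inv_equality[symmetric]) auto
  ultimately show ?thesis using n assms by (simp add: \<delta>_def A.inv_mult)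
qed

lemma carrier_Q: "carrier Q = carrier A \<times> carrier H"
  and one_Q: "\<one>\<^bsub>Q\<^esub> = (\<one>\<^bsub>A\<^esub>, \<one>\<^bsub>H\<^esub>)"
  and mult_Q: "(a, h) \<otimes>\<^bsub>Q\<^esub> (b, k) = (a \<otimes>\<^bsub>A\<^esub> b \<otimes>\<^bsub>A\<^esub> \<mu> h k, h \<otimes>\<^bsub>H\<^esub> k)"
  by (simp_all add: twisted_product_def)

lemma loop_Q: "loop Q"
proof
  fix x y assume "x \<in> carrier Q" "y \<in> carrier Q"
  then obtain a h b k where *: "x = (a, h)" "y = (b, k)"
    "a \<in> carrier A" "b \<in> carrier A" "h \<in> carrier H" "k \<in> carrier H"
    by (auto simp: carrier_Q)
  show "x \<otimes>\<^bsub>Q\<^esub> y \<in> carrier Q"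
    using * by (simp add: carrier_Q mult_Q)
  show "\<exists>!z. z \<in> carrier Q \<and> x \<otimes>\<^bsub>Q\<^esub> z = y"
  proof (rule ex1I)
    let ?l = "inv\<^bsub>H\<^esub> h \<otimes>\<^bsub>H\<^esub> k"
    let ?c = "inv\<^bsub>A\<^esub> a \<otimes>\<^bsub>A\<^esub> b \<otimes>\<^bsub>A\<^esub> inv\<^bsub>A\<^esub> \<mu> h ?l"
    have "a \<otimes>\<^bsub>A\<^esub> ?c \<otimes>\<^bsub>A\<^esub> \<mu> h ?l = b"
      using * by (subst A.mult_mult_eq_iff) auto
    then show "(?c, ?l) \<in> carrier Q \<and> x \<otimes>\<^bsub>Q\<^esub> (?c, ?l) = y"
      using * by (simp add: carrier_Q mult_Q flip: H.m_assoc)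
    fix z assume z: "z \<in> carrier Q \<and> x \<otimes>\<^bsub>Q\<^esub> z = y"
    then obtain c l where cl: "z = (c, l)" "c \<in> carrier A" "l \<in> carrier H"
      by (auto simp: carrier_Q)
    then have "h \<otimes>\<^bsub>H\<^esub> l = k" "a \<otimes>\<^bsub>A\<^esub> c \<otimes>\<^bsub>A\<^esub> \<mu> h l = b"
      using z * by (auto simp: mult_Q)
    then have "l = ?l" "c = inv\<^bsub>A\<^esub> a \<otimes>\<^bsub>A\<^esub> b \<otimes>\<^bsub>A\<^esub> inv\<^bsub>A\<^esub> \<mu> h l"
      using * cl A.mult_mult_eq_iff[of a b "\<mu> h l" c] by (auto simp flip: H.m_assoc)
    then show "z = (?c, ?l)" using cl by simp
  qed
  show "\<exists>!z. z \<in> carrier Q \<and> z \<otimes>\<^bsub>Q\<^esub> x = y"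
  proof (rule ex1I)
    let ?l = "k \<otimes>\<^bsub>H\<^esub> inv\<^bsub>H\<^esub> h"
    let ?c = "inv\<^bsub>A\<^esub> a \<otimes>\<^bsub>A\<^esub> b \<otimes>\<^bsub>A\<^esub> inv\<^bsub>A\<^esub> \<mu> ?l h"
    have "a \<otimes>\<^bsub>A\<^esub> ?c \<otimes>\<^bsub>A\<^esub> \<mu> ?l h = b"
      using * by (subst A.mult_mult_eq_iff) auto
    then have "?c \<otimes>\<^bsub>A\<^esub> a \<otimes>\<^bsub>A\<^esub> \<mu> ?l h = b"
      using * by (subst A.m_comm[of ?c a]) auto
    then show "(?c, ?l) \<in> carrier Q \<and> (?c, ?l) \<otimes>\<^bsub>Q\<^esub> x = y"
      using * by (simp add: carrier_Q mult_Q H.m_assoc)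
    fix z assume z: "z \<in> carrier Q \<and> z \<otimes>\<^bsub>Q\<^esub> x = y"
    then obtain c l where cl: "z = (c, l)" "c \<in> carrier A" "l \<in> carrier H"
      by (auto simp: carrier_Q)
    then have l: "l \<otimes>\<^bsub>H\<^esub> h = k" and c: "a \<otimes>\<^bsub>A\<^esub> c \<otimes>\<^bsub>A\<^esub> \<mu> l h = b"
      using z * A.m_comm[of a c] by (auto simp: mult_Q)
    have "l = ?l" "c = inv\<^bsub>A\<^esub> a \<otimes>\<^bsub>A\<^esub> b \<otimes>\<^bsub>A\<^esub> inv\<^bsub>A\<^esub> \<mu> l h"
      using l c * cl A.mult_mult_eq_iff[of a b "\<mu> l h" c] by (auto simp: H.m_assoc)
    then show "z = (?c, ?l)" using cl by simp
  qed
qed (auto simp: carrier_Q one_Q mult_Q mu_one_left mu_one_right)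

sublocale Q: loop Q by (rule loop_Q)

subsection \<open>The inner mapping group\<close>

text \<open>
  The inner mapping \<open>R\<^sub>x\<^sup>-\<^sup>1 L\<^sub>x\<close> acts on the second component as conjugation by \<open>x\<close>. Written as
  \<open>z \<mapsto> z [z, x\<^sup>-\<^sup>1]\<close>, it visibly preserves the cosets of the center.
\<close>

lemma conj_eq:
  assumes "x \<in> carrier H" "z \<in> carrier H"
  shows "x \<otimes>\<^bsub>H\<^esub> z = (z \<otimes>\<^bsub>H\<^esub> commutator H z (inv\<^bsub>H\<^esub> x)) \<otimes>\<^bsub>H\<^esub> x"
proof -
  have "z \<otimes>\<^bsub>H\<^esub> commutator H z (inv\<^bsub>H\<^esub> x) = x \<otimes>\<^bsub>H\<^esub> z \<otimes>\<^bsub>H\<^esub> inv\<^bsub>H\<^esub> x"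
    using assms by (simp add: commutator_def conjugate_def flip: H.m_assoc)
  then show ?thesis using assms by (simp add: H.m_assoc)
qed

lemma commutator_mult_central:
  assumes "x \<in> carrier H" "z \<in> carrier H" "n \<in> N"
  shows "commutator H (z \<otimes>\<^bsub>H\<^esub> n) x = commutator H z x"
  using assms H.center_closed[OF assms(3)]
  by (simp add: H.commutator_mult_left H.commutator_central_left)

text \<open>
  Left and right inner mappings fix the second component. That their factor \<open>\<phi>\<close> is constant on the
  cosets of the center makes them commute with the conjugations of the second component.
\<close>

definition vertical :: "('c \<times> 'a \<Rightarrow> 'c \<times> 'a) \<Rightarrow> bool" where
  "vertical p \<longleftrightarrow> (\<exists>\<phi>. (\<forall>z \<in> carrier H. \<phi> z \<in> carrier A) \<and>
     (\<forall>z \<in> carrier H. \<forall>n \<in> N. \<phi> (z \<otimes>\<^bsub>H\<^esub> n) = \<phi> z) \<and>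
     (\<forall>a \<in> carrier A. \<forall>z \<in> carrier H. p (a, z) = (a \<otimes>\<^bsub>A\<^esub> \<phi> z, z)))"

text \<open>
  The factor by which the inner mapping \<open>R\<^sub>x\<^sup>-\<^sup>1 L\<^sub>x\<close> changes the first component: it is the solution \<open>s\<close> of
  \<open>s \<mu>(x z x\<^sup>-\<^sup>1, x) = \<mu>(x, z)\<close>.
\<close>

definition shift :: "'a \<Rightarrow> 'a \<Rightarrow> 'c" where
  "shift x z = \<mu> x z \<otimes>\<^bsub>A\<^esub> inv\<^bsub>A\<^esub> \<mu> (z \<otimes>\<^bsub>H\<^esub> commutator H z (inv\<^bsub>H\<^esub> x)) x"

definition conj_like :: "'a \<Rightarrow> ('c \<times> 'a \<Rightarrow> 'c \<times> 'a) \<Rightarrow> bool" where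
  "conj_like x p \<longleftrightarrow> (\<forall>a \<in> carrier A. \<forall>z \<in> carrier H.
     p (a, z) = (a \<otimes>\<^bsub>A\<^esub> shift x z, z \<otimes>\<^bsub>H\<^esub> commutator H z (inv\<^bsub>H\<^esub> x)))"

lemma shift_closed:
  assumes "x \<in> carrier H" "z \<in> carrier H"
  shows "shift x z \<in> carrier A"
  using assms H.commutator_center H.center_closed by (simp add: shift_def)

text \<open>
  This is where \<open>\<delta>\<close> enters: when two conjugations are composed, the second one is applied at a point
  moved by a central element, and its factor changes by a value of \<open>\<delta>\<close>.
\<close>

lemma shift_mult_central:
  assumes x: "x \<in> carrier H" and z: "z \<in> carrier H" and n: "n \<in> N"
  shows "shift x (z \<otimes>\<^bsub>H\<^esub> n) = shift x z \<otimes>\<^bsub>A\<^esub> inv\<^bsub>A\<^esub> \<delta> n x"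
proof -
  let ?c = "commutator H z (inv\<^bsub>H\<^esub> x)"
  have c: "?c \<in> N" "?c \<in> carrier H" "n \<in> carrier H"
    using x z n H.commutator_center H.center_closed by auto
  have "z \<otimes>\<^bsub>H\<^esub> n \<otimes>\<^bsub>H\<^esub> ?c = (z \<otimes>\<^bsub>H\<^esub> ?c) \<otimes>\<^bsub>H\<^esub> n"
    using c z H.center_commute[OF n c(2)] by (simp add: H.m_assoc)
  then have "\<mu> (z \<otimes>\<^bsub>H\<^esub> n \<otimes>\<^bsub>H\<^esub> ?c) x = \<mu> (z \<otimes>\<^bsub>H\<^esub> ?c) x \<otimes>\<^bsub>A\<^esub> \<mu> n x"
    using c x z n by (simp add: mu_mult_left)
  moreover have "\<mu> x (z \<otimes>\<^bsub>H\<^esub> n) = \<mu> x z \<otimes>\<^bsub>A\<^esub> \<mu> x n"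
    using c x z n by (simp add: mu_mult_right)
  ultimately show ?thesis
    using c x z n by (simp add: shift_def commutator_mult_central \<delta>_def A.inv_mult A.m_ac)
qed

text \<open>
  For left inner mappings the factor is \<open>\<phi>(z) = \<mu>(u, z) \<mu>(v, u z) \<mu>(v, u)\<^sup>-\<^sup>1 \<mu>(v u, z)\<^sup>-\<^sup>1\<close>. Replacing \<open>z\<close> by
  \<open>z n\<close> with \<open>n\<close> central multiplies both \<open>\<mu>(u, z) \<mu>(v, u z)\<close> and \<open>\<mu>(v u, z)\<close> by
  \<open>\<mu>(u, n) \<mu>(v, n)\<close>, which cancels. Right inner mappings are treated in the mirrored way.
\<close>

lemma inner_map_gens_shape:
  assumes "p \<in> inner_map_gens Q"
  shows "p \<in> Bij (carrier Q) \<and> (vertical p \<or> (\<exists>x \<in> carrier H. conj_like x p))"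
  using assms
proof (cases rule: Q.inner_map_gens_cases)
  case (left x y)
  obtain a u b v where *: "x = (a, u)" "y = (b, v)" "a \<in> carrier A" "b \<in> carrier A"
    "u \<in> carrier H" "v \<in> carrier H" using left by (auto simp: carrier_Q)
  define \<phi> where "\<phi> z = \<mu> u z \<otimes>\<^bsub>A\<^esub> \<mu> v (u \<otimes>\<^bsub>H\<^esub> z) \<otimes>\<^bsub>A\<^esub> inv\<^bsub>A\<^esub> (\<mu> v u \<otimes>\<^bsub>A\<^esub> \<mu> (v \<otimes>\<^bsub>H\<^esub> u) z)" for z
  have \<phi>A: "\<phi> z \<in> carrier A" if "z \<in> carrier H" for z
    using * that by (simp add: \<phi>_def)
  have \<phi>N: "\<phi> (z \<otimes>\<^bsub>H\<^esub> n) = \<phi> z" if z: "z \<in> carrier H" and n: "n \<in> N" for z n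
  proof -
    have nH: "n \<in> carrier H" using n H.center_closed by simp
    have e: "\<mu> v (u \<otimes>\<^bsub>H\<^esub> (z \<otimes>\<^bsub>H\<^esub> n)) = \<mu> v (u \<otimes>\<^bsub>H\<^esub> z) \<otimes>\<^bsub>A\<^esub> \<mu> v n"
      using * z n nH by (simp add: mu_mult_right flip: H.m_assoc)
    let ?m = "\<mu> u n \<otimes>\<^bsub>A\<^esub> \<mu> v n"
    have m: "?m \<in> carrier A" using * nH by simp
    have "\<phi> (z \<otimes>\<^bsub>H\<^esub> n) = \<phi> z \<otimes>\<^bsub>A\<^esub> (?m \<otimes>\<^bsub>A\<^esub> inv\<^bsub>A\<^esub> ?m)"
      unfolding \<phi>_def e using * z n nH
      by (simp add: mu_mult_right mu_mult_left A.inv_mult A.m_ac del: A.r_inv A.l_inv A.Units_r_inv A.Units_l_inv)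
    then show ?thesis using m \<phi>A[OF z] by simp
  qed
  have "p (c, z) = (c \<otimes>\<^bsub>A\<^esub> \<phi> z, z)" if cz: "c \<in> carrier A" "z \<in> carrier H" for c z
  proof -
    let ?m = "\<mu> v u \<otimes>\<^bsub>A\<^esub> \<mu> (v \<otimes>\<^bsub>H\<^esub> u) z"
    have m: "?m \<in> carrier A" using * cz by simp
    have "b \<otimes>\<^bsub>A\<^esub> a \<otimes>\<^bsub>A\<^esub> \<mu> v u \<otimes>\<^bsub>A\<^esub> (c \<otimes>\<^bsub>A\<^esub> \<phi> z) \<otimes>\<^bsub>A\<^esub> \<mu> (v \<otimes>\<^bsub>H\<^esub> u) z
      = b \<otimes>\<^bsub>A\<^esub> (a \<otimes>\<^bsub>A\<^esub> c \<otimes>\<^bsub>A\<^esub> \<mu> u z) \<otimes>\<^bsub>A\<^esub> \<mu> v (u \<otimes>\<^bsub>H\<^esub> z) \<otimes>\<^bsub>A\<^esub> (?m \<otimes>\<^bsub>A\<^esub> inv\<^bsub>A\<^esub> ?m)"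
      unfolding \<phi>_def using * cz m
      by (simp add: A.inv_mult A.m_ac del: A.r_inv A.l_inv A.Units_r_inv A.Units_l_inv)
    also have "\<dots> = b \<otimes>\<^bsub>A\<^esub> (a \<otimes>\<^bsub>A\<^esub> c \<otimes>\<^bsub>A\<^esub> \<mu> u z) \<otimes>\<^bsub>A\<^esub> \<mu> v (u \<otimes>\<^bsub>H\<^esub> z)"
      using m * cz by simp
    finally have "(y \<otimes>\<^bsub>Q\<^esub> x) \<otimes>\<^bsub>Q\<^esub> (c \<otimes>\<^bsub>A\<^esub> \<phi> z, z) = y \<otimes>\<^bsub>Q\<^esub> (x \<otimes>\<^bsub>Q\<^esub> (c, z))"
      using * cz by (simp add: mult_Q H.m_assoc)
    then show ?thesis
      using left(4) cz \<phi>A by (simp add: carrier_Q)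
  qed
  then have "vertical p" unfolding vertical_def using \<phi>A \<phi>N by blast
  with left(3) show ?thesis by simp
next
  case (right x y)
  obtain a u b v where *: "x = (a, u)" "y = (b, v)" "a \<in> carrier A" "b \<in> carrier A"
    "u \<in> carrier H" "v \<in> carrier H" using right by (auto simp: carrier_Q)
  define \<phi> where "\<phi> z = \<mu> z u \<otimes>\<^bsub>A\<^esub> \<mu> (z \<otimes>\<^bsub>H\<^esub> u) v \<otimes>\<^bsub>A\<^esub> inv\<^bsub>A\<^esub> (\<mu> u v \<otimes>\<^bsub>A\<^esub> \<mu> z (u \<otimes>\<^bsub>H\<^esub> v))" for z
  have \<phi>A: "\<phi> z \<in> carrier A" if "z \<in> carrier H" for z
    using * that by (simp add: \<phi>_def)
  have \<phi>N: "\<phi> (z \<otimes>\<^bsub>H\<^esub> n) = \<phi> z" if z: "z \<in> carrier H" and n: "n \<in> N" for z n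
  proof -
    have nH: "n \<in> carrier H" using n H.center_closed by simp
    have "z \<otimes>\<^bsub>H\<^esub> n \<otimes>\<^bsub>H\<^esub> u = z \<otimes>\<^bsub>H\<^esub> u \<otimes>\<^bsub>H\<^esub> n"
      using * z nH H.center_commute[OF n] by (simp add: H.m_assoc)
    then have e: "\<mu> (z \<otimes>\<^bsub>H\<^esub> n \<otimes>\<^bsub>H\<^esub> u) v = \<mu> (z \<otimes>\<^bsub>H\<^esub> u) v \<otimes>\<^bsub>A\<^esub> \<mu> n v"
      using * z n nH by (simp add: mu_mult_left)
    let ?m = "\<mu> n u \<otimes>\<^bsub>A\<^esub> \<mu> n v"
    have m: "?m \<in> carrier A" using * nH by simp
    have "\<phi> (z \<otimes>\<^bsub>H\<^esub> n) = \<phi> z \<otimes>\<^bsub>A\<^esub> (?m \<otimes>\<^bsub>A\<^esub> inv\<^bsub>A\<^esub> ?m)"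
      unfolding \<phi>_def e using * z n nH
      by (simp add: mu_mult_right mu_mult_left A.inv_mult A.m_ac del: A.r_inv A.l_inv A.Units_r_inv A.Units_l_inv)
    then show ?thesis using m \<phi>A[OF z] by simp
  qed
  have "p (c, z) = (c \<otimes>\<^bsub>A\<^esub> \<phi> z, z)" if cz: "c \<in> carrier A" "z \<in> carrier H" for c z
  proof -
    let ?m = "\<mu> u v \<otimes>\<^bsub>A\<^esub> \<mu> z (u \<otimes>\<^bsub>H\<^esub> v)"
    have m: "?m \<in> carrier A" using * cz by simp
    have "c \<otimes>\<^bsub>A\<^esub> \<phi> z \<otimes>\<^bsub>A\<^esub> (a \<otimes>\<^bsub>A\<^esub> b \<otimes>\<^bsub>A\<^esub> \<mu> u v) \<otimes>\<^bsub>A\<^esub> \<mu> z (u \<otimes>\<^bsub>H\<^esub> v)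
      = c \<otimes>\<^bsub>A\<^esub> a \<otimes>\<^bsub>A\<^esub> \<mu> z u \<otimes>\<^bsub>A\<^esub> b \<otimes>\<^bsub>A\<^esub> \<mu> (z \<otimes>\<^bsub>H\<^esub> u) v \<otimes>\<^bsub>A\<^esub> (?m \<otimes>\<^bsub>A\<^esub> inv\<^bsub>A\<^esub> ?m)"
      unfolding \<phi>_def using * cz m
      by (simp add: A.inv_mult A.m_ac del: A.r_inv A.l_inv A.Units_r_inv A.Units_l_inv)
    also have "\<dots> = c \<otimes>\<^bsub>A\<^esub> a \<otimes>\<^bsub>A\<^esub> \<mu> z u \<otimes>\<^bsub>A\<^esub> b \<otimes>\<^bsub>A\<^esub> \<mu> (z \<otimes>\<^bsub>H\<^esub> u) v"
      using m * cz by simp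
    finally have "(c \<otimes>\<^bsub>A\<^esub> \<phi> z, z) \<otimes>\<^bsub>Q\<^esub> (x \<otimes>\<^bsub>Q\<^esub> y) = ((c, z) \<otimes>\<^bsub>Q\<^esub> x) \<otimes>\<^bsub>Q\<^esub> y"
      using * cz by (simp add: mult_Q H.m_assoc)
    then show ?thesis
      using right(4) cz \<phi>A by (simp add: carrier_Q)
  qed
  then have "vertical p" unfolding vertical_def using \<phi>A \<phi>N by blast
  with right(3) show ?thesis by simp
next
  case (mid x)
  obtain a x' where *: "x = (a, x')" "a \<in> carrier A" "x' \<in> carrier H"
    using mid by (auto simp: carrier_Q)
  have "conj_like x' p"
    unfolding conj_like_def
  proof (intro ballI)
    fix c z assume cz: "c \<in> carrier A" "z \<in> carrier H"
    let ?z = "z \<otimes>\<^bsub>H\<^esub> commutator H z (inv\<^bsub>H\<^esub> x')"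
    have z: "?z \<in> carrier H" using * cz H.commutator_center H.center_closed by simp
    let ?m = "\<mu> ?z x'"
    have m: "?m \<in> carrier A" using z * by simp
    have "c \<otimes>\<^bsub>A\<^esub> shift x' z \<otimes>\<^bsub>A\<^esub> a \<otimes>\<^bsub>A\<^esub> ?m = a \<otimes>\<^bsub>A\<^esub> c \<otimes>\<^bsub>A\<^esub> \<mu> x' z \<otimes>\<^bsub>A\<^esub> (?m \<otimes>\<^bsub>A\<^esub> inv\<^bsub>A\<^esub> ?m)"
      unfolding shift_def using * cz m by (simp add: A.m_ac del: A.r_inv A.l_inv A.Units_r_inv A.Units_l_inv)
    also have "\<dots> = a \<otimes>\<^bsub>A\<^esub> c \<otimes>\<^bsub>A\<^esub> \<mu> x' z" using * cz m by simp
    finally have "(c \<otimes>\<^bsub>A\<^esub> shift x' z, ?z) \<otimes>\<^bsub>Q\<^esub> x = x \<otimes>\<^bsub>Q\<^esub> (c, z)"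
      using * cz conj_eq[of x' z] by (simp add: mult_Q)
    then show "p (c, z) = (c \<otimes>\<^bsub>A\<^esub> shift x' z, ?z)"
      using mid(3) cz * z shift_closed by (simp add: carrier_Q)
  qed
  with mid(2) * show ?thesis by blast
qed

text \<open>
  The swap hypothesis serves the case of two conjugation-like generators. Composed in the two
  orders, they have first components that agree up to \<open>\<delta>([z, x\<^sup>-\<^sup>1], y)\<close> in the one and
  \<open>\<delta>([z, y\<^sup>-\<^sup>1], x)\<close> in the other. By the hypothesis and since \<open>\<delta>(n, -)\<close> respects inverses for central \<open>n\<close>,
  these are the inverses of \<open>\<delta>([z, y], x)\<close> and \<open>\<delta>([z, x], y)\<close>, which are equal by the hypothesis again.
\<close>

lemma generators_commute:
  assumes delta_swap: "\<And>x y z. \<lbrakk>x \<in> carrier H; y \<in> carrier H; z \<in> carrier H\<rbrakk>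
      \<Longrightarrow> \<delta> (commutator H z y) x = \<delta> (commutator H z x) y"
    and p: "p \<in> inner_map_gens Q" and q: "q \<in> inner_map_gens Q"
  shows "p \<otimes>\<^bsub>BijGroup (carrier Q)\<^esub> q = q \<otimes>\<^bsub>BijGroup (carrier Q)\<^esub> p"
proof -
  have vv: "p (q (a, z)) = q (p (a, z))"
    if "vertical p" "vertical q" "a \<in> carrier A" "z \<in> carrier H" for p q a z
    using that unfolding vertical_def by (auto simp: A.m_ac)
  have vc: "p (q (a, z)) = q (p (a, z))"
    if "vertical p" "conj_like x q" "x \<in> carrier H" "a \<in> carrier A" "z \<in> carrier H" for p q x a z
  proof -
    have c: "commutator H z (inv\<^bsub>H\<^esub> x) \<in> N" "commutator H z (inv\<^bsub>H\<^esub> x) \<in> carrier H"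
      using that H.commutator_center H.center_closed by auto
    then show ?thesis
      using that shift_closed unfolding vertical_def conj_like_def by (auto simp: A.m_ac)
  qed
  have cc: "p (q (a, z)) = q (p (a, z))"
    if p: "conj_like x p" and q: "conj_like y q" and xy: "x \<in> carrier H" "y \<in> carrier H"
      and a: "a \<in> carrier A" and z: "z \<in> carrier H" for p q x y a z
  proof -
    let ?c = "\<lambda>x. commutator H z (inv\<^bsub>H\<^esub> x)"
    have c: "?c x \<in> N" "?c x \<in> carrier H" "?c y \<in> N" "?c y \<in> carrier H"
      using xy z H.commutator_center H.center_closed by auto
    have "\<delta> (?c x) y = inv\<^bsub>A\<^esub> \<delta> (commutator H z y) x"
      using xy z delta_swap[of "inv\<^bsub>H\<^esub> x" y z] by (simp add: delta_inv_right H.commutator_center)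
    moreover have "\<delta> (?c y) x = inv\<^bsub>A\<^esub> \<delta> (commutator H z x) y"
      using xy z delta_swap[of "inv\<^bsub>H\<^esub> y" x z] by (simp add: delta_inv_right H.commutator_center)
    ultimately have eq: "\<delta> (?c x) y = \<delta> (?c y) x"
      using delta_swap[OF xy z] by simp
    have "q (p (a, z)) =
        (a \<otimes>\<^bsub>A\<^esub> shift x z \<otimes>\<^bsub>A\<^esub> (shift y z \<otimes>\<^bsub>A\<^esub> inv\<^bsub>A\<^esub> \<delta> (?c x) y), z \<otimes>\<^bsub>H\<^esub> ?c x \<otimes>\<^bsub>H\<^esub> ?c y)"
      using p q xy a z c unfolding conj_like_def
      by (simp add: shift_closed shift_mult_central commutator_mult_central)
    moreover have "p (q (a, z)) =
        (a \<otimes>\<^bsub>A\<^esub> shift y z \<otimes>\<^bsub>A\<^esub> (shift x z \<otimes>\<^bsub>A\<^esub> inv\<^bsub>A\<^esub> \<delta> (?c y) x), z \<otimes>\<^bsub>H\<^esub> ?c y \<otimes>\<^bsub>H\<^esub> ?c x)"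
      using p q xy a z c unfolding conj_like_def
      by (simp add: shift_closed shift_mult_central commutator_mult_central)
    moreover have "z \<otimes>\<^bsub>H\<^esub> ?c x \<otimes>\<^bsub>H\<^esub> ?c y = z \<otimes>\<^bsub>H\<^esub> ?c y \<otimes>\<^bsub>H\<^esub> ?c x"
      using z c H.center_commute[OF c(1,4)] by (simp add: H.m_assoc)
    ultimately show ?thesis
      using xy a z c eq by (simp add: shift_closed delta_closed A.m_ac)
  qed
  have B: "p \<in> Bij (carrier Q)" "q \<in> Bij (carrier Q)"
    using inner_map_gens_shape p q by auto
  have "p (q u) = q (p u)" if uQ: "u \<in> carrier Q" for u
  proof -
    obtain a z where u: "u = (a, z)" "a \<in> carrier A" "z \<in> carrier H"
      using uQ by (auto simp: carrier_Q)
    from inner_map_gens_shape[OF p] inner_map_gens_shape[OF q] show ?thesis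
      unfolding u(1) using u(2,3) vv[of p q] vc[of p _ q] vc[of q _ p] cc[of _ p _ q] by metis
  qed
  then show ?thesis
    using B by (auto simp: BijGroup_def compose_def restrict_def)
qed

lemma comm_group_Inn:
  assumes "\<And>x y z. \<lbrakk>x \<in> carrier H; y \<in> carrier H; z \<in> carrier H\<rbrakk>
      \<Longrightarrow> \<delta> (commutator H z y) x = \<delta> (commutator H z x) y"
  shows "comm_group (Inn Q)"
  unfolding Inn_def
  by (rule group.generate_commuting_comm_group[OF group_BijGroup])
    (use inner_map_gens_shape generators_commute[OF assms] in \<open>auto simp: BijGroup_def\<close>)

subsection \<open>The upper central series\<close>

text \<open>The part of the center of \<open>Q\<close> in the second component.\<close>

definition "K = {n \<in> N. \<forall>w \<in> carrier H. \<mu> n w = \<mu> w n}"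

text \<open>
  With a central component among them, both bracketings acquire the same factor
  \<open>\<mu>(h, k) \<mu>(h, l) \<mu>(k, l)\<close>.
\<close>

lemma assoc_if_central:
  assumes "x \<in> carrier Q" "y \<in> carrier Q" "z \<in> carrier Q"
    and N: "{snd x, snd y, snd z} \<inter> N \<noteq> {}"
  shows "(x \<otimes>\<^bsub>Q\<^esub> y) \<otimes>\<^bsub>Q\<^esub> z = x \<otimes>\<^bsub>Q\<^esub> (y \<otimes>\<^bsub>Q\<^esub> z)"
proof -
  obtain a h b k c l where *: "x = (a, h)" "y = (b, k)" "z = (c, l)"
    "a \<in> carrier A" "b \<in> carrier A" "c \<in> carrier A"
    "h \<in> carrier H" "k \<in> carrier H" "l \<in> carrier H"
    using assms by (auto simp: carrier_Q)
  then have "\<mu> (h \<otimes>\<^bsub>H\<^esub> k) l = \<mu> h l \<otimes>\<^bsub>A\<^esub> \<mu> k l" "\<mu> h (k \<otimes>\<^bsub>H\<^esub> l) = \<mu> h k \<otimes>\<^bsub>A\<^esub> \<mu> h l"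
    using N mu_mult_left mu_mult_right by simp_all
  then show ?thesis
    using * by (simp add: mult_Q H.m_assoc A.m_ac)
qed

lemma center_Q: "center Q = carrier A \<times> K"
proof (intro equalityI subsetI)
  fix x assume x: "x \<in> center Q"
  then have "x \<in> carrier Q" and comm: "\<And>y. y \<in> carrier Q \<Longrightarrow> x \<otimes>\<^bsub>Q\<^esub> y = y \<otimes>\<^bsub>Q\<^esub> x"
    by (auto simp: center_def nucleus_def)
  then obtain a n where *: "x = (a, n)" "a \<in> carrier A" "n \<in> carrier H"
    by (auto simp: carrier_Q)
  have "n \<otimes>\<^bsub>H\<^esub> w = w \<otimes>\<^bsub>H\<^esub> n \<and> \<mu> n w = \<mu> w n" if "w \<in> carrier H" for w
    using comm[of "(\<one>\<^bsub>A\<^esub>, w)"] * that by (simp add: carrier_Q mult_Q)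
  then show "x \<in> carrier A \<times> K"
    using * by (simp add: K_def H.center_eq)
next
  fix x assume "x \<in> carrier A \<times> K"
  then obtain a n where *: "x = (a, n)" "a \<in> carrier A" "n \<in> carrier H" "n \<in> N" "n \<in> K"
    by (auto simp: K_def H.center_eq)
  have "x \<otimes>\<^bsub>Q\<^esub> y = y \<otimes>\<^bsub>Q\<^esub> x" if yQ: "y \<in> carrier Q" for y
  proof -
    obtain b h where y: "y = (b, h)" "b \<in> carrier A" "h \<in> carrier H"
      using yQ unfolding carrier_Q by blast
    have "\<mu> n h = \<mu> h n" using *(5) y(3) unfolding K_def by blast
    then show ?thesis
      unfolding *(1) y(1) mult_Q H.center_commute[OF *(4) y(3)] using A.m_comm[OF *(2) y(2)] by simp
  qed
  moreover have "x \<in> nucleus Q"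
    unfolding nucleus_def
  proof (intro CollectI conjI ballI)
    show x: "x \<in> carrier Q" using * by (simp add: carrier_Q)
    have sx: "snd x \<in> N" using * by simp
    fix y z assume yz: "y \<in> carrier Q" "z \<in> carrier Q"
    show "associator Q x y z = \<one>\<^bsub>Q\<^esub>" "associator Q y x z = \<one>\<^bsub>Q\<^esub>" "associator Q y z x = \<one>\<^bsub>Q\<^esub>"
      by (rule Q.associator_eq_one[OF _ _ _ assoc_if_central]; use x yz sx in blast)+
  qed
  ultimately show "x \<in> center Q" by (simp add: center_def)
qed

lemma K_carrier: "k \<in> K \<Longrightarrow> k \<in> carrier H"
  unfolding K_def using H.center_closed by blast

lemma K_subgroup: "subgroup K H"
proof (rule H.subgroupI)
  show "K \<subseteq> carrier H" using K_carrier by blast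
  have "\<one>\<^bsub>H\<^esub> \<in> K" using one_N mu_one_left mu_one_right by (simp add: K_def)
  then show "K \<noteq> {}" by blast
  fix m n assume m: "m \<in> K" and n: "n \<in> K"
  then have mn: "m \<in> N" "n \<in> N" "m \<in> carrier H" "n \<in> carrier H"
    and eq: "\<And>w. w \<in> carrier H \<Longrightarrow> \<mu> w m = \<mu> m w" "\<And>w. w \<in> carrier H \<Longrightarrow> \<mu> w n = \<mu> n w"
    using H.center_closed unfolding K_def by auto
  have "inv\<^bsub>H\<^esub> m \<in> N" "m \<otimes>\<^bsub>H\<^esub> n \<in> N"
    using mn subgroup.m_inv_closed[OF H.center_subgroup] subgroup.m_closed[OF H.center_subgroup]
    by auto
  moreover have "\<mu> (inv\<^bsub>H\<^esub> m) w = \<mu> w (inv\<^bsub>H\<^esub> m)" if "w \<in> carrier H" for w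
    by (simp only: mu_inv_left[OF mn(1) that] mu_inv_right[OF mn(1) that] eq(1)[OF that])
  moreover have "\<mu> (m \<otimes>\<^bsub>H\<^esub> n) w = \<mu> w (m \<otimes>\<^bsub>H\<^esub> n)" if "w \<in> carrier H" for w
  proof -
    have "\<mu> (m \<otimes>\<^bsub>H\<^esub> n) w = \<mu> m w \<otimes>\<^bsub>A\<^esub> \<mu> n w" "\<mu> w (m \<otimes>\<^bsub>H\<^esub> n) = \<mu> w m \<otimes>\<^bsub>A\<^esub> \<mu> w n"
      using mn that by (auto intro: mu_mult_left mu_mult_right)
    then show ?thesis by (simp only: eq[OF that])
  qed
  ultimately show "inv\<^bsub>H\<^esub> m \<in> K" "m \<otimes>\<^bsub>H\<^esub> n \<in> K"
    by (simp_all add: K_def)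
qed

sublocale K: normal K H
  by (rule H.normal_if_subset_center[OF K_subgroup]) (auto simp: K_def)

text \<open>
  The coset of \<open>(1, h)\<close> modulo the center of \<open>Q\<close>. The first component is arbitrary, so \<open>\<mu>\<close> leaves no trace
  in the product of two such cosets, and \<open>proj\<close> is a homomorphism from \<open>H\<close> onto \<open>Q/Z(Q)\<close>.
\<close>

definition proj :: "'a \<Rightarrow> ('c \<times> 'a) set" where
  "proj h = carrier A \<times> (K #>\<^bsub>H\<^esub> h)"

lemma r_coset_Q:
  assumes "b \<in> carrier A" "h \<in> carrier H"
  shows "center Q #>\<^bsub>Q\<^esub> (b, h) = proj h"
proof (intro equalityI subsetI)
  fix x assume "x \<in> center Q #>\<^bsub>Q\<^esub> (b, h)"
  then show "x \<in> proj h"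
    using assms by (auto simp: center_Q r_coset_def mult_Q proj_def K_carrier)
next
  fix x assume "x \<in> proj h"
  then obtain a k where *: "x = (a, k \<otimes>\<^bsub>H\<^esub> h)" "a \<in> carrier A" "k \<in> K" "k \<in> carrier H"
    by (auto simp: proj_def r_coset_def K_carrier)
  let ?c = "inv\<^bsub>A\<^esub> b \<otimes>\<^bsub>A\<^esub> a \<otimes>\<^bsub>A\<^esub> inv\<^bsub>A\<^esub> \<mu> k h"
  have "b \<otimes>\<^bsub>A\<^esub> ?c \<otimes>\<^bsub>A\<^esub> \<mu> k h = a"
    using * assms by (subst A.mult_mult_eq_iff) auto
  then have "?c \<otimes>\<^bsub>A\<^esub> b \<otimes>\<^bsub>A\<^esub> \<mu> k h = a"
    using * assms by (subst A.m_comm[of ?c b]) auto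
  then have "x = (?c, k) \<otimes>\<^bsub>Q\<^esub> (b, h)" using * by (simp add: mult_Q)
  moreover have "(?c, k) \<in> center Q" using * assms by (simp add: center_Q)
  ultimately show "x \<in> center Q #>\<^bsub>Q\<^esub> (b, h)" by (auto simp: r_coset_def)
qed

lemma set_mult_proj:
  assumes uv: "u \<in> carrier H" "v \<in> carrier H"
  shows "proj u <#>\<^bsub>Q\<^esub> proj v = proj (u \<otimes>\<^bsub>H\<^esub> v)"
proof -
  have sub: "K #>\<^bsub>H\<^esub> w \<subseteq> carrier H" if "w \<in> carrier H" for w
    using H.r_coset_subset_G[OF K.subset that] .
  have prod: "K #>\<^bsub>H\<^esub> (u \<otimes>\<^bsub>H\<^esub> v) = (K #>\<^bsub>H\<^esub> u) <#>\<^bsub>H\<^esub> (K #>\<^bsub>H\<^esub> v)"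
    using K.rcos_sum[OF uv] by simp
  show ?thesis
  proof (intro equalityI subsetI)
    fix x assume "x \<in> proj u <#>\<^bsub>Q\<^esub> proj v"
    then obtain a h b k where *: "x = (a, h) \<otimes>\<^bsub>Q\<^esub> (b, k)" "a \<in> carrier A" "b \<in> carrier A"
      "h \<in> K #>\<^bsub>H\<^esub> u" "k \<in> K #>\<^bsub>H\<^esub> v"
      unfolding set_mult_def proj_def by blast
    then have "h \<in> carrier H" "k \<in> carrier H" using sub uv by auto
    with * show "x \<in> proj (u \<otimes>\<^bsub>H\<^esub> v)"
      by (auto simp: mult_Q proj_def prod set_mult_def)
  next
    fix x assume "x \<in> proj (u \<otimes>\<^bsub>H\<^esub> v)"
    then obtain a h k where *: "x = (a, h \<otimes>\<^bsub>H\<^esub> k)" "a \<in> carrier A"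
      "h \<in> K #>\<^bsub>H\<^esub> u" "k \<in> K #>\<^bsub>H\<^esub> v"
      unfolding proj_def prod set_mult_def by blast
    then have hk: "h \<in> carrier H" "k \<in> carrier H" using sub uv by auto
    then have "x = (a \<otimes>\<^bsub>A\<^esub> inv\<^bsub>A\<^esub> \<mu> h k, h) \<otimes>\<^bsub>Q\<^esub> (\<one>\<^bsub>A\<^esub>, k)"
      using * by (simp add: mult_Q A.m_assoc)
    moreover have "(a \<otimes>\<^bsub>A\<^esub> inv\<^bsub>A\<^esub> \<mu> h k, h) \<in> proj u" "(\<one>\<^bsub>A\<^esub>, k) \<in> proj v"
      using * hk by (simp_all add: proj_def)
    ultimately show "x \<in> proj u <#>\<^bsub>Q\<^esub> proj v"
      unfolding set_mult_def by blast
  qed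
qed

abbreviation "P \<equiv> center_quot Q"

lemma carrier_P: "carrier P = proj ` carrier H"
proof -
  have r: "center Q #>\<^bsub>Q\<^esub> x = proj (snd x)" if "x \<in> carrier Q" for x
    using that r_coset_Q by (cases x) (simp add: carrier_Q)
  have "carrier P = (\<lambda>x. center Q #>\<^bsub>Q\<^esub> x) ` carrier Q"
    unfolding center_quot_def by (rule carrier_FactGroup)
  also have "\<dots> = (\<lambda>x. proj (snd x)) ` carrier Q"
    by (rule image_cong[OF refl r])
  also have "\<dots> = proj ` (snd ` carrier Q)"
    by (simp only: image_image)
  also have "snd ` carrier Q = carrier H"
    unfolding carrier_Q using A.one_closed by (subst snd_image_times) auto
  finally show ?thesis .
qed

lemma mult_P:
  "\<lbrakk>u \<in> carrier H; v \<in> carrier H\<rbrakk> \<Longrightarrow> proj u \<otimes>\<^bsub>P\<^esub> proj v = proj (u \<otimes>\<^bsub>H\<^esub> v)"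
  unfolding center_quot_def mult_FactGroup by (rule set_mult_proj)

lemma one_P: "\<one>\<^bsub>P\<^esub> = proj \<one>\<^bsub>H\<^esub>"
  unfolding center_quot_def one_FactGroup proj_def center_Q
  by (simp only: H.coset_mult_one[OF K.subset])

lemma group_P: "group P"
proof -
  have "proj \<in> hom H P"
  proof (rule homI)
    show "proj h \<in> carrier P" if "h \<in> carrier H" for h
      unfolding carrier_P using that by (rule imageI)
    show "proj (h \<otimes>\<^bsub>H\<^esub> k) = proj h \<otimes>\<^bsub>P\<^esub> proj k" if "h \<in> carrier H" "k \<in> carrier H" for h k
      using mult_P[OF that] by (rule sym)
  qed
  from H.hom_imp_img_group[OF this]
  have "group (P\<lparr>carrier := carrier P, one := \<one>\<^bsub>P\<^esub>\<rparr>)"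
    by (simp only: carrier_P one_P)
  moreover have "P\<lparr>carrier := carrier P, one := \<one>\<^bsub>P\<^esub>\<rparr> = P"
    by (rule monoid.equality) simp_all
  ultimately show ?thesis by (simp only:)
qed

text \<open>
  If the cosets of \<open>u\<close> and \<open>v\<close> commuted in \<open>Q/Z(Q)\<close>, then \<open>[u, v]\<close> would lie in \<open>K\<close> and \<open>\<delta>([u, v], -)\<close> would be
  trivial. So \<open>Q/Z(Q)\<close> is a nonabelian image of a group of class two.
\<close>

lemma class_three:
  assumes uvw: "u \<in> carrier H" "v \<in> carrier H" "w \<in> carrier H"
    and nontriv: "\<delta> (commutator H u v) w \<noteq> \<one>\<^bsub>A\<^esub>"
  shows "nilpotency_class_three Q"
proof -
  interpret P: group P by (rule group_P)
  let ?c = "commutator H u v"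
  have c: "?c \<in> N" "?c \<in> carrier H" using uvw H.commutator_center H.center_closed by auto
  have uv: "v \<otimes>\<^bsub>H\<^esub> u \<otimes>\<^bsub>H\<^esub> ?c = u \<otimes>\<^bsub>H\<^esub> v"
  proof -
    have "u \<otimes>\<^bsub>H\<^esub> ?c = inv\<^bsub>H\<^esub> v \<otimes>\<^bsub>H\<^esub> u \<otimes>\<^bsub>H\<^esub> v"
      using uvw by (simp add: commutator_def conjugate_def flip: H.m_assoc)
    then have "v \<otimes>\<^bsub>H\<^esub> (u \<otimes>\<^bsub>H\<^esub> ?c) = u \<otimes>\<^bsub>H\<^esub> v"
      using uvw by (simp flip: H.m_assoc)
    then show ?thesis using uvw c by (simp add: H.m_assoc)
  qed
  have noncomm: "proj u \<otimes>\<^bsub>P\<^esub> proj v \<noteq> proj v \<otimes>\<^bsub>P\<^esub> proj u"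
  proof
    assume "proj u \<otimes>\<^bsub>P\<^esub> proj v = proj v \<otimes>\<^bsub>P\<^esub> proj u"
    then have "proj (u \<otimes>\<^bsub>H\<^esub> v) = proj (v \<otimes>\<^bsub>H\<^esub> u)"
      using uvw by (simp add: mult_P)
    then have "K #>\<^bsub>H\<^esub> (u \<otimes>\<^bsub>H\<^esub> v) = K #>\<^bsub>H\<^esub> (v \<otimes>\<^bsub>H\<^esub> u)"
      using A.one_closed unfolding proj_def by (auto simp: times_eq_iff)
    then have "u \<otimes>\<^bsub>H\<^esub> v \<in> K #>\<^bsub>H\<^esub> (v \<otimes>\<^bsub>H\<^esub> u)"
      using H.rcos_self[OF _ K_subgroup, of "u \<otimes>\<^bsub>H\<^esub> v"] uvw by simp
    then obtain k where k: "k \<in> K" "u \<otimes>\<^bsub>H\<^esub> v = k \<otimes>\<^bsub>H\<^esub> (v \<otimes>\<^bsub>H\<^esub> u)"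
      unfolding r_coset_def by blast
    then have kN: "k \<in> N" unfolding K_def by blast
    have "k \<otimes>\<^bsub>H\<^esub> (v \<otimes>\<^bsub>H\<^esub> u) = v \<otimes>\<^bsub>H\<^esub> u \<otimes>\<^bsub>H\<^esub> k"
      using H.center_commute[OF kN] uvw by simp
    then have "v \<otimes>\<^bsub>H\<^esub> u \<otimes>\<^bsub>H\<^esub> ?c = v \<otimes>\<^bsub>H\<^esub> u \<otimes>\<^bsub>H\<^esub> k"
      unfolding uv k(2) .
    then have "?c = k"
      using K_carrier[OF k(1)] c uvw by simp
    moreover have "\<mu> k w = \<mu> w k" using k(1) uvw(3) unfolding K_def by blast
    ultimately have "\<delta> ?c w = \<one>\<^bsub>A\<^esub>"
      unfolding \<delta>_def using uvw(3) K_carrier[OF k(1)] by simp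
    then show False using nontriv by simp
  qed
  have "\<exists>z \<in> center P. x \<otimes>\<^bsub>P\<^esub> y = z \<otimes>\<^bsub>P\<^esub> (y \<otimes>\<^bsub>P\<^esub> x)" if xy: "x \<in> carrier P" "y \<in> carrier P" for x y
  proof -
    obtain h k where hk: "x = proj h" "y = proj k" "h \<in> carrier H" "k \<in> carrier H"
      using xy by (auto simp: carrier_P)
    define z where "z = commutator H k (inv\<^bsub>H\<^esub> h)"
    have z: "z \<in> N" "z \<in> carrier H" using hk H.commutator_center H.center_closed by (auto simp: z_def)
    have "h \<otimes>\<^bsub>H\<^esub> k = k \<otimes>\<^bsub>H\<^esub> z \<otimes>\<^bsub>H\<^esub> h"
      unfolding z_def by (rule conj_eq[OF hk(3,4)])
    also have "\<dots> = z \<otimes>\<^bsub>H\<^esub> (k \<otimes>\<^bsub>H\<^esub> h)"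
      unfolding H.center_commute[OF z(1) hk(4), symmetric] using z hk by (simp add: H.m_assoc)
    finally have "x \<otimes>\<^bsub>P\<^esub> y = proj z \<otimes>\<^bsub>P\<^esub> (y \<otimes>\<^bsub>P\<^esub> x)" using hk z by (simp add: mult_P)
    moreover have "proj z \<in> center P"
      unfolding P.center_eq carrier_P
    proof (intro CollectI conjI ballI)
      show "proj z \<in> proj ` carrier H" using z by blast
      fix y assume "y \<in> proj ` carrier H"
      then obtain l where l: "y = proj l" "l \<in> carrier H" by blast
      show "proj z \<otimes>\<^bsub>P\<^esub> y = y \<otimes>\<^bsub>P\<^esub> proj z"
        unfolding l(1) mult_P[OF z(2) l(2)] mult_P[OF l(2) z(2)] H.center_commute[OF z(1) l(2)] ..
    qed
    ultimately show ?thesis by blast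
  qed
  then have "trivial_loop (center_quot (center_quot P))"
    by (rule P.trivial_loop_second_center_quot)
  moreover have "\<not> trivial_loop (center_quot P)"
    using P.commute_if_trivial_loop_center_quot[of "proj u" "proj v"] noncomm uvw
    by (auto simp: carrier_P)
  moreover have "\<not> trivial_loop P"
  proof
    assume "trivial_loop P"
    moreover have "proj u \<in> carrier P" "proj v \<in> carrier P" using uvw by (auto simp: carrier_P)
    ultimately have "proj u = \<one>\<^bsub>P\<^esub>" "proj v = \<one>\<^bsub>P\<^esub>" by (auto simp: trivial_loop_def)
    then show False using noncomm by simp
  qed
  moreover have "\<not> trivial_loop Q"
  proof
    assume "trivial_loop Q"
    then have "carrier H = {\<one>\<^bsub>H\<^esub>}"
      using A.one_closed by (auto simp: trivial_loop_def carrier_Q one_Q)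
    then show False using noncomm uvw by simp
  qed
  ultimately show ?thesis by (simp add: nilpotency_class_three_def)
qed

end

section \<open>Lifting the trilinear form through the commutator map\<close>

text \<open>
  Choosing a homomorphism \<open>g(-, w)\<close> for each \<open>w\<close> separately makes \<open>g\<close> multiplicative in \<open>w\<close> as well,
  because homomorphisms on the center are determined by their values on commutators. The two
  variables of the commutator are extended from generators to the group one after the other.
\<close>

lemma (in class_two_group) commutator_form_factors:
  fixes e :: "'i::linorder \<Rightarrow> 'a" and I :: "'i set"
  defines "Z \<equiv> G\<lparr>carrier := center G\<rparr>"
    and "J \<equiv> {(i, j). i \<in> I \<and> j \<in> I \<and> i < j}"
  assumes A: "elementary_abelian_2 A" and Z: "elementary_abelian_2 Z"
    and e: "\<And>i. i \<in> I \<Longrightarrow> e i \<in> carrier G"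
    and gen: "generate G (center G \<union> e ` I) = carrier G"
    and basis: "basis_2 Z J (\<lambda>(i, j). commutator G (e i) (e j))"
    and F_closed: "\<And>u v w. \<lbrakk>u \<in> carrier G; v \<in> carrier G; w \<in> carrier G\<rbrakk> \<Longrightarrow> F u v w \<in> carrier A"
    and F_mult1: "\<And>u u' v w. \<lbrakk>u \<in> carrier G; u' \<in> carrier G; v \<in> carrier G; w \<in> carrier G\<rbrakk>
      \<Longrightarrow> F (u \<otimes> u') v w = F u v w \<otimes>\<^bsub>A\<^esub> F u' v w"
    and F_mult3: "\<And>u v w w'. \<lbrakk>u \<in> carrier G; v \<in> carrier G; w \<in> carrier G; w' \<in> carrier G\<rbrakk>
      \<Longrightarrow> F u v (w \<otimes> w') = F u v w \<otimes>\<^bsub>A\<^esub> F u v w'"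
    and F_swap: "\<And>u v w. \<lbrakk>u \<in> carrier G; v \<in> carrier G; w \<in> carrier G\<rbrakk> \<Longrightarrow> F v u w = F u v w"
    and F_alt: "\<And>u w. \<lbrakk>u \<in> carrier G; w \<in> carrier G\<rbrakk> \<Longrightarrow> F u u w = \<one>\<^bsub>A\<^esub>"
    and F_central1: "\<And>c v w. \<lbrakk>c \<in> center G; v \<in> carrier G; w \<in> carrier G\<rbrakk> \<Longrightarrow> F c v w = \<one>\<^bsub>A\<^esub>"
    and F_central3: "\<And>u v c. \<lbrakk>u \<in> carrier G; v \<in> carrier G; c \<in> center G\<rbrakk> \<Longrightarrow> F u v c = \<one>\<^bsub>A\<^esub>"
  shows "\<exists>g. (\<forall>w \<in> carrier G. (\<lambda>c. g c w) \<in> hom Z A) \<and>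
    (\<forall>c \<in> center G. g c \<in> hom G A) \<and>
    (\<forall>c \<in> center G. \<forall>c' \<in> center G. g c c' = \<one>\<^bsub>A\<^esub>) \<and>
    (\<forall>u \<in> carrier G. \<forall>v \<in> carrier G. \<forall>w \<in> carrier G. g (commutator G u v) w = F u v w)"
proof -
  interpret A: comm_group A using A by (simp add: elementary_abelian_2_def)
  interpret Z: comm_group Z using Z by (simp add: elementary_abelian_2_def)
  have Z_simps [simp]: "carrier Z = center G" "x \<otimes>\<^bsub>Z\<^esub> y = x \<otimes> y" for x y
    by (simp_all add: Z_def)
  have sqA: "x \<otimes>\<^bsub>A\<^esub> x = \<one>\<^bsub>A\<^esub>" if "x \<in> carrier A" for x
    using A that by (simp add: elementary_abelian_2_def)
  have ex: "\<exists>\<phi>. \<phi> \<in> hom Z A \<and> (\<forall>(i, j) \<in> J. \<phi> (commutator G (e i) (e j)) = F (e i) (e j) w)"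
    if "w \<in> carrier G" for w
  proof -
    have "(\<lambda>(i, j). F (e i) (e j) w) \<in> J \<rightarrow> carrier A"
      using that e F_closed by (auto simp: J_def)
    from elementary_abelian_2_extend_basis[OF Z A basis this] show ?thesis
      by (auto simp: case_prod_beta)
  qed
  define h where "h w = (SOME \<phi>. \<phi> \<in> hom Z A \<and>
    (\<forall>(i, j) \<in> J. \<phi> (commutator G (e i) (e j)) = F (e i) (e j) w))" for w
  define g where "g c w = h w c" for c w
  have h: "h w \<in> hom Z A \<and> (\<forall>(i, j) \<in> J. h w (commutator G (e i) (e j)) = F (e i) (e j) w)"
    if "w \<in> carrier G" for w
    unfolding h_def using ex[OF that] by (rule someI_ex)
  have g_hom: "(\<lambda>c. g c w) \<in> hom Z A" if "w \<in> carrier G" for w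
    using h[OF that] by (simp add: g_def)
  have g_e: "g (commutator G (e i) (e j)) w = F (e i) (e j) w"
    if "i \<in> I" "j \<in> I" "i < j" "w \<in> carrier G" for i j w
    using h[OF that(4)] that(1-3) by (auto simp: g_def J_def)
  have g_closed: "g c w \<in> carrier A" if "c \<in> center G" "w \<in> carrier G" for c w
    using hom_in_carrier[OF g_hom] that by simp
  have g_mult: "g (c \<otimes> c') w = g c w \<otimes>\<^bsub>A\<^esub> g c' w"
    if "c \<in> center G" "c' \<in> center G" "w \<in> carrier G" for c c' w
    using hom_mult[OF g_hom] that by simp
  have g_one: "g \<one> w = \<one>\<^bsub>A\<^esub>" if "w \<in> carrier G" for w
    using g_mult[of \<one> \<one> w] g_closed[of \<one> w] that subgroup.one_closed[OF center_subgroup] by simp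
  have g_inv: "g (inv c) w = g c w" if "c \<in> center G" "w \<in> carrier G" for c w
  proof -
    have "c \<otimes> c = \<one>" using Z that(1) by (simp add: elementary_abelian_2_def Z_def)
    then have "inv c = c" using that center_closed inv_eq_self_if_square by blast
    then show ?thesis by simp
  qed
  have left_hom: "(\<lambda>u. g (commutator G u v) w) \<in> hom G A" if "v \<in> carrier G" "w \<in> carrier G" for v w
    using that by (intro homI) (simp_all add: commutator_center g_closed commutator_mult_left g_mult)
  have right_hom: "(\<lambda>v. g (commutator G u v) w) \<in> hom G A" if "u \<in> carrier G" "w \<in> carrier G" for u w
    using that by (intro homI) (simp_all add: commutator_center g_closed commutator_mult_right g_mult)
  have F_hom: "(\<lambda>u. F u v w) \<in> hom G A" if "v \<in> carrier G" "w \<in> carrier G" for v w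
    using that by (intro homI) (simp_all add: F_closed F_mult1)
  have F_hom2: "(\<lambda>v. F u v w) \<in> hom G A" if "u \<in> carrier G" "w \<in> carrier G" for u w
    using that by (intro homI) (simp_all add: F_swap[of _ u w] F_closed F_mult1)
  have gens: "center G \<union> e ` I \<subseteq> carrier G" using center_closed e by blast
  have base: "g (commutator G (e i) (e j)) w = F (e i) (e j) w"
    if ij: "i \<in> I" "j \<in> I" and w: "w \<in> carrier G" for i j w
  proof (cases i j rule: linorder_cases)
    case less
    then show ?thesis using g_e ij w by blast
  next
    case equal
    then show ?thesis using ij w e by (simp add: commutator_self g_one F_alt)
  next
    case greater
    then show ?thesis
      using ij w e g_e[OF ij(2,1)] F_swap[of "e i" "e j" w]
      by (simp add: commutator_swap[of "e j" "e i"] g_inv commutator_center)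
  qed
  have step1: "g (commutator G u (e j)) w = F u (e j) w"
    if u: "u \<in> carrier G" and j: "j \<in> I" and w: "w \<in> carrier G" for u j w
  proof (rule hom_eq_on_generate[OF is_group A.is_group left_hom F_hom gens])
    fix s assume "s \<in> center G \<union> e ` I"
    then show "g (commutator G s (e j)) w = F s (e j) w"
      using base j w e by (auto simp: commutator_central_left g_one F_central1)
  qed (use u j w e gen in auto)
  have g_F: "g (commutator G u v) w = F u v w"
    if u: "u \<in> carrier G" and v: "v \<in> carrier G" and w: "w \<in> carrier G" for u v w
  proof (rule hom_eq_on_generate[OF is_group A.is_group right_hom F_hom2 gens])
    fix s assume s: "s \<in> center G \<union> e ` I"
    then have "F u s w = \<one>\<^bsub>A\<^esub>" if "s \<in> center G"
      using F_swap[of s u w] F_central1[of s u w] center_closed that u w by simp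
    then show "g (commutator G u s) w = F u s w"
      using s step1 u w by (auto simp: commutator_central_right g_one)
  qed (use u v w gen in auto)
  have Z_gen: "generate Z ((\<lambda>(i, j). commutator G (e i) (e j)) ` J) = center G"
    and Z_sub: "(\<lambda>(i, j). commutator G (e i) (e j)) ` J \<subseteq> center G"
    using basis e by (auto simp: basis_2_def J_def commutator_center)
  have g_right: "g c (w \<otimes> w') = g c w \<otimes>\<^bsub>A\<^esub> g c w'"
    if c: "c \<in> center G" and w: "w \<in> carrier G" "w' \<in> carrier G" for c w w'
  proof (rule hom_eq_on_generate[OF Z.is_group A.is_group,
        where \<phi> = "\<lambda>c. g c (w \<otimes> w')" and \<psi> = "\<lambda>c. g c w \<otimes>\<^bsub>A\<^esub> g c w'"])
    show "(\<lambda>c. g c (w \<otimes> w')) \<in> hom Z A" using g_hom w by simp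
    show "(\<lambda>c. g c w \<otimes>\<^bsub>A\<^esub> g c w') \<in> hom Z A"
      using w by (intro homI) (simp_all add: g_closed g_mult A.m_ac)
    show "c \<in> generate Z ((\<lambda>(i, j). commutator G (e i) (e j)) ` J)" using c Z_gen by simp
    fix s assume "s \<in> (\<lambda>(i, j). commutator G (e i) (e j)) ` J"
    then obtain i j where "s = commutator G (e i) (e j)" "i \<in> I" "j \<in> I" by (auto simp: J_def)
    then show "g s (w \<otimes> w') = g s w \<otimes>\<^bsub>A\<^esub> g s w'"
      using w e by (simp add: g_F F_mult3)
  qed (use Z_sub in simp)
  have g_central: "g c c' = \<one>\<^bsub>A\<^esub>" if c: "c \<in> center G" "c' \<in> center G" for c c'
  proof (rule hom_eq_on_generate[OF Z.is_group A.is_group,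
        where \<phi> = "\<lambda>c. g c c'" and \<psi> = "\<lambda>_. \<one>\<^bsub>A\<^esub>"])
    show "(\<lambda>c. g c c') \<in> hom Z A" using g_hom c center_closed by simp
    show "(\<lambda>_. \<one>\<^bsub>A\<^esub>) \<in> hom Z A" by (intro homI) simp_all
    show "c \<in> generate Z ((\<lambda>(i, j). commutator G (e i) (e j)) ` J)" using c Z_gen by simp
    fix s assume "s \<in> (\<lambda>(i, j). commutator G (e i) (e j)) ` J"
    then obtain i j where "s = commutator G (e i) (e j)" "i \<in> I" "j \<in> I" by (auto simp: J_def)
    then show "g s c' = \<one>\<^bsub>A\<^esub>"
      using c e center_closed by (simp add: g_F F_central3)
  qed (use Z_sub in simp)
  have "g c \<in> hom G A" if "c \<in> center G" for c
    using that by (intro homI) (simp_all add: g_closed g_right)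
  then show ?thesis using g_hom g_central g_F by blast
qed

text \<open>
  Divide \<open>u\<close> by a representative of its coset; the representative of \<open>K\<close> itself has to be the neutral
  element for \<open>K\<close> to be fixed.
\<close>

lemma (in group) subgroup_retraction:
  assumes K: "subgroup K G"
  shows "\<exists>\<zeta>. (\<forall>u \<in> carrier G. \<zeta> u \<in> K) \<and> (\<forall>k \<in> K. \<zeta> k = k) \<and>
    (\<forall>k \<in> K. \<forall>u \<in> carrier G. \<zeta> (k \<otimes> u) = k \<otimes> \<zeta> u)"
proof -
  interpret K: subgroup K G by (rule K)
  define r where "r Y = (if Y = K then \<one> else SOME y. y \<in> Y)" for Y
  define \<zeta> where "\<zeta> u = u \<otimes> inv r (K #> u)" for u
  have r: "r (K #> u) \<in> K #> u" if "u \<in> carrier G" for u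
    using rcos_self[OF that K] unfolding r_def by (auto intro: someI)
  have rG: "r (K #> u) \<in> carrier G" if "u \<in> carrier G" for u
    using r[OF that] r_coset_subset_G[OF K.subset that] by blast
  have coset: "K #> (k \<otimes> u) = K #> u" if "k \<in> K" "u \<in> carrier G" for k u
    using that coset_mult_assoc[OF K.subset K.mem_carrier[OF that(1)] that(2)]
      coset_join2[OF K.mem_carrier[OF that(1)] K that(1)] by simp
  have "\<zeta> u \<in> K" if u: "u \<in> carrier G" for u
  proof -
    obtain k where k: "k \<in> K" "r (K #> u) = k \<otimes> u" using r[OF u] by (auto simp: r_coset_def)
    then have "\<zeta> u = inv k"
      using u K.mem_carrier by (simp add: \<zeta>_def inv_mult_group flip: m_assoc)
    then show ?thesis using k by simp
  qed
  moreover have "\<zeta> k = k" if "k \<in> K" for k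
    using that coset_join2[OF K.mem_carrier[OF that] K that] K.mem_carrier by (simp add: \<zeta>_def r_def)
  moreover have "\<zeta> (k \<otimes> u) = k \<otimes> \<zeta> u" if "k \<in> K" "u \<in> carrier G" for k u
    using that rG K.mem_carrier by (simp add: \<zeta>_def coset m_assoc)
  ultimately show ?thesis by blast
qed

text \<open>
  In the second argument \<open>g\<close> is multiplicative anyway. In the first one either \<open>\<zeta>\<close> is multiplicative on
  the pair, because one of its members is central, or the second argument is central and every value
  is trivial.
\<close>

lemma (in class_two_group) twist_from_form:
  assumes A: "comm_group A"
    and \<zeta>_center: "\<And>u. u \<in> carrier G \<Longrightarrow> \<zeta> u \<in> center G"
    and \<zeta>_mult: "\<And>c u. \<lbrakk>c \<in> center G; u \<in> carrier G\<rbrakk> \<Longrightarrow> \<zeta> (c \<otimes> u) = c \<otimes> \<zeta> u"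
    and \<zeta>_id: "\<And>c. c \<in> center G \<Longrightarrow> \<zeta> c = c"
    and g_left: "\<And>w. w \<in> carrier G \<Longrightarrow> (\<lambda>c. g c w) \<in> hom (G\<lparr>carrier := center G\<rparr>) A"
    and g_right: "\<And>c. c \<in> center G \<Longrightarrow> g c \<in> hom G A"
    and g_central: "\<And>c c'. \<lbrakk>c \<in> center G; c' \<in> center G\<rbrakk> \<Longrightarrow> g c c' = \<one>\<^bsub>A\<^esub>"
  shows "class_two_twist A G (\<lambda>u v. g (\<zeta> u) v)"
proof -
  interpret A: comm_group A by (rule A)
  have g_closed: "g c w \<in> carrier A" if "c \<in> center G" "w \<in> carrier G" for c w
    using hom_in_carrier[OF g_right] that by blast
  have g_mult_left: "g (c \<otimes> c') w = g c w \<otimes>\<^bsub>A\<^esub> g c' w"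
    if "c \<in> center G" "c' \<in> center G" "w \<in> carrier G" for c c' w
    using hom_mult[OF g_left] that by simp
  show ?thesis
  proof unfold_locales
    fix u v w assume uvw: "u \<in> carrier G" "v \<in> carrier G" "w \<in> carrier G"
      and Z: "{u, v, w} \<inter> center G \<noteq> {}"
    show "g (\<zeta> u) (v \<otimes> w) = g (\<zeta> u) v \<otimes>\<^bsub>A\<^esub> g (\<zeta> u) w"
      using uvw hom_mult[OF g_right[OF \<zeta>_center]] by simp
    consider "u \<in> center G \<or> v \<in> center G" | "w \<in> center G" using Z by blast
    then show "g (\<zeta> (u \<otimes> v)) w = g (\<zeta> u) w \<otimes>\<^bsub>A\<^esub> g (\<zeta> v) w"
    proof cases
      case 1
      then have "\<zeta> (u \<otimes> v) = \<zeta> u \<otimes> \<zeta> v"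
      proof
        assume "u \<in> center G"
        then show ?thesis using uvw by (simp add: \<zeta>_mult \<zeta>_id)
      next
        assume v: "v \<in> center G"
        then have "\<zeta> (u \<otimes> v) = v \<otimes> \<zeta> u"
          using center_commute[OF v uvw(1)] \<zeta>_mult[OF v uvw(1)] by simp
        also have "\<dots> = \<zeta> u \<otimes> \<zeta> v"
          using center_commute[OF v center_closed[OF \<zeta>_center[OF uvw(1)]]] \<zeta>_id[OF v] by simp
        finally show ?thesis .
      qed
      then show ?thesis using uvw by (simp add: g_mult_left \<zeta>_center)
    next
      case 2
      then show ?thesis using uvw by (simp add: g_central \<zeta>_center)
    qed
  qed (simp add: g_closed \<zeta>_center)
qed

section \<open>Construction of the loop\<close>

text \<open>A generating set of a quotient lifts, once the kernel is added, to a generating set of the group.\<close>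

lemma (in normal) generate_from_quotient:
  assumes e: "\<And>i. i \<in> I \<Longrightarrow> e i \<in> carrier G"
    and gen: "generate (G Mod H) ((\<lambda>i. H #> e i) ` I) = carrier (G Mod H)"
  shows "generate G (H \<union> e ` I) = carrier G"
proof
  have sub: "H \<union> e ` I \<subseteq> carrier G" using e subset by blast
  show "generate G (H \<union> e ` I) \<subseteq> carrier G"
    using generate_in_carrier[OF sub] by blast
  interpret S: subgroup "generate G (H \<union> e ` I)" G
    by (rule generate_is_subgroup[OF sub])
  have coset: "H #> e i \<subseteq> generate G (H \<union> e ` I)" if "i \<in> I" for i
    using that unfolding r_coset_def by (blast intro: generate.eng generate.incl)
  have inc: "Y \<subseteq> generate G (H \<union> e ` I)"
    if "Y \<in> generate (G Mod H) ((\<lambda>i. H #> e i) ` I)" for Y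
    using that
  proof induction
    case one
    show ?case by (auto intro: generate.incl)
  next
    case (incl Y)
    then show ?case using coset by blast
  next
    case (inv Y)
    then obtain i where i: "i \<in> I" "Y = H #> e i" by blast
    then have "Y \<in> carrier (G Mod H)" using e by (auto simp: carrier_FactGroup)
    then have "inv\<^bsub>G Mod H\<^esub> Y = set_inv Y" by (rule inv_FactGroup)
    moreover have "Y \<subseteq> generate G (H \<union> e ` I)"
      using i coset by blast
    ultimately show ?case by (auto simp: SET_INV_def)
  next
    case (eng X1 X2)
    then show ?case by (auto simp: set_mult_def intro!: generate.eng)
  qed
  show "carrier G \<subseteq> generate G (H \<union> e ` I)"
  proof
    fix x assume x: "x \<in> carrier G"
    then have "H #> x \<in> carrier (G Mod H)" by (auto simp: carrier_FactGroup)
    then show "x \<in> generate G (H \<union> e ` I)"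
      using inc[of "H #> x"] rcos_self[OF x is_subgroup] gen by blast
  qed
qed

lemma (in group) commutator_in_derived:
  assumes "u \<in> carrier G" "v \<in> carrier G"
  shows "commutator G u v \<in> commutator_subgroup G"
proof -
  have "commutator G u v = inv u \<otimes> inv v \<otimes> inv (inv u) \<otimes> inv (inv v)"
    using assms by (simp add: commutator_def conjugate_def m_assoc)
  also have "\<dots> \<in> derived_set G (carrier G)"
    using assms inv_closed by blast
  finally show ?thesis unfolding derived_def by (rule generate.incl)
qed

lemma comm_group_sign_grp: "comm_group sign_grp"
proof (rule comm_groupI)
  fix x assume "x \<in> carrier sign_grp"
  then show "\<exists>y \<in> carrier sign_grp. y \<otimes>\<^bsub>sign_grp\<^esub> x = \<one>\<^bsub>sign_grp\<^esub>"
    by (intro bexI[of _ x]) (auto simp: sign_grp_def)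
qed (auto simp: sign_grp_def)

lemma elementary_abelian_2_sign_grp: "elementary_abelian_2 sign_grp"
  unfolding elementary_abelian_2_def using comm_group_sign_grp by (auto simp: sign_grp_def)

lemma conjugate_DirProd:
  assumes "comm_group A" "group H" "a \<in> carrier A" "b \<in> carrier A" "h \<in> carrier H" "k \<in> carrier H"
  shows "conjugate (A \<times>\<times> H) (a, h) (b, k) = (a, conjugate H h k)"
proof -
  interpret A: comm_group A by fact
  interpret H: group H by fact
  have "inv\<^bsub>A\<^esub> b \<otimes>\<^bsub>A\<^esub> a \<otimes>\<^bsub>A\<^esub> b = a \<otimes>\<^bsub>A\<^esub> (inv\<^bsub>A\<^esub> b \<otimes>\<^bsub>A\<^esub> b)"
    using assms by (simp add: A.m_ac del: A.l_inv A.r_inv A.Units_l_inv A.Units_r_inv)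
  also have "\<dots> = a" using assms by simp
  finally show ?thesis
    using assms by (simp add: conjugate_def inv_DirProd A.is_group)
qed

theorem mainTheorem1:
  fixes H :: "('a, 'm) monoid_scheme"
    and d :: nat
    and e :: "nat \<Rightarrow> 'a"
    and f :: "'a set \<Rightarrow> 'a set \<Rightarrow> 'a set \<Rightarrow> int"
  defines "H' \<equiv> commutator_subgroup H"
    and "A \<equiv> sign_grp"
  defines "G \<equiv> A \<times>\<times> H"
    and "V \<equiv> H Mod H'"
  assumes "group H"
    and "nilpotency_class_two H"
    and "H' = center H"
    and "\<And>i. i \<in> {1..d} \<Longrightarrow> e i \<in> carrier H"
    and "elementary_abelian_2 V"
    and "basis_2 V {1..d} (\<lambda>i. H' #>\<^bsub>H\<^esub> e i)"
    and "elementary_abelian_2 (H\<lparr>carrier := H'\<rparr>)"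
    and "basis_2 (H\<lparr>carrier := H'\<rparr>) {(i, j). 1 \<le> i \<and> i < j \<and> j \<le> d}
           (\<lambda>(i, j). commutator H (e i) (e j))"
    and "sym_trilinear_alternating V A f"
  shows "\<exists>\<delta> \<mu>.
    (\<forall>u \<in> carrier H. \<forall>v \<in> carrier H. \<delta> u v \<in> carrier A \<and> \<mu> u v \<in> carrier A) \<and>
    (\<forall>u \<in> carrier H. \<forall>v \<in> carrier H. \<forall>w \<in> carrier H.
       f (H' #>\<^bsub>H\<^esub> u) (H' #>\<^bsub>H\<^esub> v) (H' #>\<^bsub>H\<^esub> w) = \<delta> (commutator H u v) w) \<and>
    (\<forall>u \<in> carrier H. \<forall>v \<in> carrier H. \<delta> u v = \<mu> u v \<otimes>\<^bsub>A\<^esub> inv\<^bsub>A\<^esub> (\<mu> v u)) \<and>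
    (\<forall>u \<in> carrier H. \<forall>v \<in> carrier H. \<forall>w \<in> carrier H. {u, v, w} \<inter> H' \<noteq> {} \<longrightarrow>
       \<mu> (u \<otimes>\<^bsub>H\<^esub> v) w = \<mu> u w \<otimes>\<^bsub>A\<^esub> \<mu> v w \<and>
       \<mu> u (v \<otimes>\<^bsub>H\<^esub> w) = \<mu> u v \<otimes>\<^bsub>A\<^esub> \<mu> u w) \<and>
    (\<forall>x \<in> carrier G. \<forall>y \<in> carrier G. \<forall>z \<in> carrier G.
       conjugate G z (y \<otimes>\<^bsub>G\<^esub> x) \<otimes>\<^bsub>G\<^esub> (\<delta> (snd (commutator G z y)) (snd x), \<one>\<^bsub>H\<^esub>) =
       conjugate G z (x \<otimes>\<^bsub>G\<^esub> y) \<otimes>\<^bsub>G\<^esub> (\<delta> (snd (commutator G z x)) (snd y), \<one>\<^bsub>H\<^esub>)) \<and>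
    ((\<exists>u \<in> carrier V. \<exists>v \<in> carrier V. \<exists>w \<in> carrier V. f u v w \<noteq> \<one>\<^bsub>A\<^esub>) \<longrightarrow>
       loop (twisted_product A H \<mu>) \<and>
       nilpotency_class_three (twisted_product A H \<mu>) \<and>
       comm_group (Inn (twisted_product A H \<mu>)))"
proof -
  interpret H: group H by fact
  have H'_center: "H' = center H" by fact
  interpret H: class_two_group H
    by unfold_locales (use H.commutator_in_derived H'_center H'_def in simp)
  interpret N: normal H' H
    unfolding H'_center by (rule H.normal_if_subset_center[OF H.center_subgroup order_refl])
  have A2: "elementary_abelian_2 A" unfolding A_def by (rule elementary_abelian_2_sign_grp)
  then interpret A: comm_group A by (simp add: elementary_abelian_2_def)
  have Z2: "elementary_abelian_2 (H\<lparr>carrier := center H\<rparr>)"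
    using \<open>elementary_abelian_2 (H\<lparr>carrier := H'\<rparr>)\<close> H'_center by simp
  have e: "e i \<in> carrier H" if "i \<in> {1..d}" for i using that by fact
  have J: "{(i, j). 1 \<le> i \<and> i < j \<and> j \<le> d} = {(i, j). i \<in> {1..d} \<and> j \<in> {1..d} \<and> i < j}"
    by auto
  have basis: "basis_2 (H\<lparr>carrier := center H\<rparr>) {(i, j). i \<in> {1..d} \<and> j \<in> {1..d} \<and> i < j}
      (\<lambda>(i, j). commutator H (e i) (e j))"
    using \<open>basis_2 (H\<lparr>carrier := H'\<rparr>) _ _\<close> unfolding J H'_center .
  have gen: "generate H (center H \<union> e ` {1..d}) = carrier H"
    using N.generate_from_quotient[of "{1..d}" e] e \<open>basis_2 V _ _\<close>
    unfolding basis_2_def V_def H'_center by blast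
  have f: "sym_trilinear_alternating V A f" by fact
  define p where "p u = H' #>\<^bsub>H\<^esub> u" for u
  have p_V: "p u \<in> carrier V" if "u \<in> carrier H" for u
    using that by (auto simp: p_def V_def carrier_FactGroup)
  have p_mult: "p (u \<otimes>\<^bsub>H\<^esub> v) = p u \<otimes>\<^bsub>V\<^esub> p v" if "u \<in> carrier H" "v \<in> carrier H" for u v
    using N.rcos_sum[OF that] by (simp add: p_def V_def)
  define F where "F u v w = f (p u) (p v) (p w)" for u v w
  have F_closed: "F u v w \<in> carrier A"
    and F_sym: "F v u w = F u v w" "F u w v = F u v w"
    if "u \<in> carrier H" "v \<in> carrier H" "w \<in> carrier H" for u v w
    using f p_V[OF that(1)] p_V[OF that(2)] p_V[OF that(3)]
    unfolding sym_trilinear_alternating_def F_def by blast+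
  have F_mult1: "F (u \<otimes>\<^bsub>H\<^esub> u') v w = F u v w \<otimes>\<^bsub>A\<^esub> F u' v w"
    and F_mult3: "F v w (u \<otimes>\<^bsub>H\<^esub> u') = F v w u \<otimes>\<^bsub>A\<^esub> F v w u'"
    if "u \<in> carrier H" "u' \<in> carrier H" "v \<in> carrier H" "w \<in> carrier H" for u u' v w
    using f p_V[OF that(1)] p_V[OF that(2)] p_V[OF that(3)] p_V[OF that(4)]
    unfolding sym_trilinear_alternating_def F_def p_mult[OF that(1,2)] by blast+
  have F_alt: "F u u w = \<one>\<^bsub>A\<^esub>" if "u \<in> carrier H" "w \<in> carrier H" for u w
    using f p_V[OF that(1)] p_V[OF that(2)]
    unfolding sym_trilinear_alternating_def F_def by blast
  have p_center: "p c = p \<one>\<^bsub>H\<^esub>" if "c \<in> center H" for c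
    using H.coset_join2[OF H.center_closed[OF that] N.is_subgroup] that H'_center N.subset
    by (simp add: p_def)
  have F_central1: "F c v w = \<one>\<^bsub>A\<^esub>" if c: "c \<in> center H" and vw: "v \<in> carrier H" "w \<in> carrier H" for c v w
  proof -
    have "F c v w = F \<one>\<^bsub>H\<^esub> v w" using p_center[OF c] by (simp add: F_def)
    also have "\<dots> = \<one>\<^bsub>A\<^esub>"
      using F_mult1[of "\<one>\<^bsub>H\<^esub>" "\<one>\<^bsub>H\<^esub>" v w] F_closed[of "\<one>\<^bsub>H\<^esub>" v w] vw by simp
    finally show ?thesis .
  qed
  have F_central3: "F u v c = \<one>\<^bsub>A\<^esub>" if uv: "u \<in> carrier H" "v \<in> carrier H" and c: "c \<in> center H" for u v c
    using F_sym(2)[OF uv(1) H.center_closed[OF c] uv(2)] F_sym(1)[OF H.center_closed[OF c] uv]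
      F_central1[OF c uv] by simp
  obtain g where g_left: "\<And>w. w \<in> carrier H \<Longrightarrow> (\<lambda>c. g c w) \<in> hom (H\<lparr>carrier := center H\<rparr>) A"
    and g_right: "\<And>c. c \<in> center H \<Longrightarrow> g c \<in> hom H A"
    and g_central: "\<And>c c'. \<lbrakk>c \<in> center H; c' \<in> center H\<rbrakk> \<Longrightarrow> g c c' = \<one>\<^bsub>A\<^esub>"
    and g_F: "\<And>u v w. \<lbrakk>u \<in> carrier H; v \<in> carrier H; w \<in> carrier H\<rbrakk> \<Longrightarrow> g (commutator H u v) w = F u v w"
    using H.commutator_form_factors[OF A2 Z2 e gen basis F_closed F_mult1 F_mult3 F_sym(1)
        F_alt F_central1 F_central3] by blast
  obtain \<zeta> where \<zeta>: "\<And>u. u \<in> carrier H \<Longrightarrow> \<zeta> u \<in> center H" "\<And>c. c \<in> center H \<Longrightarrow> \<zeta> c = c"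
    "\<And>c u. \<lbrakk>c \<in> center H; u \<in> carrier H\<rbrakk> \<Longrightarrow> \<zeta> (c \<otimes>\<^bsub>H\<^esub> u) = c \<otimes>\<^bsub>H\<^esub> \<zeta> u"
    using H.subgroup_retraction[OF H.center_subgroup] by metis
  define \<mu> where "\<mu> = (\<lambda>u v. g (\<zeta> u) v)"
  interpret T: class_two_twist A H \<mu>
    unfolding \<mu>_def
    by (rule H.twist_from_form[OF A.comm_group_axioms \<zeta>(1,3,2) g_left g_right g_central])
  have \<delta>_F: "T.\<delta> (commutator H u v) w = F u v w"
    if "u \<in> carrier H" "v \<in> carrier H" "w \<in> carrier H" for u v w
  proof -
    have c: "commutator H u v \<in> center H" using that by (simp add: H.commutator_center)
    have "T.\<delta> (commutator H u v) w = g (commutator H u v) w \<otimes>\<^bsub>A\<^esub> inv\<^bsub>A\<^esub> \<one>\<^bsub>A\<^esub>"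
      unfolding T.\<delta>_def unfolding \<mu>_def using c that by (simp add: \<zeta> g_central)
    then show ?thesis using that F_closed by (simp add: g_F)
  qed
  have \<delta>_swap: "T.\<delta> (commutator H z y) x = T.\<delta> (commutator H z x) y"
    if "x \<in> carrier H" "y \<in> carrier H" "z \<in> carrier H" for x y z
    using that F_sym(2) by (simp add: \<delta>_F)
  have conj: "conjugate G z (y \<otimes>\<^bsub>G\<^esub> x) \<otimes>\<^bsub>G\<^esub> (T.\<delta> (snd (commutator G z y)) (snd x), \<one>\<^bsub>H\<^esub>) =
       conjugate G z (x \<otimes>\<^bsub>G\<^esub> y) \<otimes>\<^bsub>G\<^esub> (T.\<delta> (snd (commutator G z x)) (snd y), \<one>\<^bsub>H\<^esub>)"
    if xyz: "x \<in> carrier G" "y \<in> carrier G" "z \<in> carrier G" for x y z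
  proof -
    obtain a u b v c w where *: "x = (a, u)" "y = (b, v)" "z = (c, w)"
      "a \<in> carrier A" "b \<in> carrier A" "c \<in> carrier A"
      "u \<in> carrier H" "v \<in> carrier H" "w \<in> carrier H"
      using xyz by (auto simp: G_def)
    have "snd (commutator G (c, w) (b', v')) = commutator H w v'"
      if "b' \<in> carrier A" "v' \<in> carrier H" for b' v'
      using * that unfolding commutator_def[of G] G_def
      by (simp add: conjugate_DirProd A.comm_group_axioms A.is_group H.is_group inv_DirProd commutator_def)
    then show ?thesis
      using * H.conjugate_mult_swap[of u v w] \<delta>_swap[of u v w]
      by (simp add: G_def conjugate_DirProd A.comm_group_axioms H.is_group)
  qed
  have loop: "loop (twisted_product A H \<mu>) \<and> nilpotency_class_three (twisted_product A H \<mu>) \<and>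
      comm_group (Inn (twisted_product A H \<mu>))"
    if nontrivial: "\<exists>u \<in> carrier V. \<exists>v \<in> carrier V. \<exists>w \<in> carrier V. f u v w \<noteq> \<one>\<^bsub>A\<^esub>"
  proof -
    have "carrier V = p ` carrier H" by (auto simp: V_def p_def carrier_FactGroup)
    then obtain u v w where uvw: "u \<in> carrier H" "v \<in> carrier H" "w \<in> carrier H" and "F u v w \<noteq> \<one>\<^bsub>A\<^esub>"
      using nontrivial by (auto simp: F_def)
    then have "T.\<delta> (commutator H u v) w \<noteq> \<one>\<^bsub>A\<^esub>" by (simp add: \<delta>_F)
    then show ?thesis
      using T.loop_Q T.class_three[OF uvw] T.comm_group_Inn[OF \<delta>_swap] by blast
  qed
  show ?thesis
  proof (rule exI[of _ T.\<delta>], rule exI[of _ \<mu>], intro conjI ballI impI)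
    fix u v assume uv: "u \<in> carrier H" "v \<in> carrier H"
    show "T.\<delta> u v \<in> carrier A" "\<mu> u v \<in> carrier A"
      using T.delta_closed[OF uv] T.mu_closed[OF uv] .
    show "T.\<delta> u v = \<mu> u v \<otimes>\<^bsub>A\<^esub> inv\<^bsub>A\<^esub> \<mu> v u" by (rule T.\<delta>_def)
    fix w assume w: "w \<in> carrier H"
    show "f (H' #>\<^bsub>H\<^esub> u) (H' #>\<^bsub>H\<^esub> v) (H' #>\<^bsub>H\<^esub> w) = T.\<delta> (commutator H u v) w"
      unfolding \<delta>_F[OF uv w] F_def p_def ..
    assume "{u, v, w} \<inter> H' \<noteq> {}"
    then have "{u, v, w} \<inter> center H \<noteq> {}" unfolding H'_center .
    from T.mu_mult_left[OF uv w this] T.mu_mult_right[OF uv w this]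
    show "\<mu> (u \<otimes>\<^bsub>H\<^esub> v) w = \<mu> u w \<otimes>\<^bsub>A\<^esub> \<mu> v w"
      "\<mu> u (v \<otimes>\<^bsub>H\<^esub> w) = \<mu> u v \<otimes>\<^bsub>A\<^esub> \<mu> u w" .
  qed (use conj loop in simp_all)
qed

end
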